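(* Let $k\ge 2$ be an integer, $\varepsilon>0$ a constant, and consider the random graph process $\{G_i\}_{i=0}^{\binom{n}{2}}$ on $n$ vertices. Then with high probability (as $n\to\infty$, with $k$ and $\varepsilon$ fixed) the following holds simultaneously for every integer $m$ with $\frac{1+\varepsilon}{6}\, n\log n\le m\le \binom n2$: the $k$-core of $G_m$ is $(1/2-\varepsilon,k)$-resilient with respect to $k$-connectivity.
   Context: Random graph process: $G_0$ is the empty graph on $n$ vertices; for each $i\in\{1,\dots,\binom n2\}$, $G_i$ is obtained from $G_{i-1}$ by adding an edge $e\notin E(G_{i-1})$ chosen uniformly at random among the missing edges. With high probability: with probability tending to $1$ as $n\to\infty$. $\log$ is the natural logarithm. $k$-core: the (possibly empty) graph obtained from a graph by successively removing vertices of degree less than $k$. A graph is $k$-connected if the removal of at most $k-1$ vertices does not disconnect it. $(\alpha,k)$-resilience: Let $G=(V,E)$ be a graph, $\mathcal P$ a monotone increasing graph property, $\alpha$ a real constant, and $k\ge1$ an integer. $G$ is $(\alpha,k)$-resilient with respect to $\mathcal P$ if for every spanning subgraph $H\subseteq G$ such that $\deg_H(v)\le\alpha\deg_G(v)$ and $\deg_{G-H}(v)\ge k$ for all $v\in V$, we have $G-H\in\mathcal P$, where $G-H$ is the graph on $V$ with edge set $E(G)\setminus E(H)$. (Here it is applied with $G$ being the $k$-core, so degrees are taken in the $k$-core.) *)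

theory Defs
  imports "HOL-Probability.Probability"
begin

section \<open>Finite simple graphs\<close>

text \<open>Undirected edges are two-element sets of vertices.\<close>

datatype 'a ugraph = Graph (verts: "'a set") (edges: "'a set set")

definition deg :: "'a ugraph \<Rightarrow> 'a \<Rightarrow> nat" where
  "deg G v = card {e \<in> edges G. v \<in> e}"

definition complete_edges :: "'a set \<Rightarrow> 'a set set" where
  "complete_edges V = {e. e \<subseteq> V \<and> card e = 2}"

definition spanning_subgraph :: "'a ugraph \<Rightarrow> 'a ugraph \<Rightarrow> bool" where
  "spanning_subgraph H G \<longleftrightarrow> verts H = verts G \<and> edges H \<subseteq> edges G"

definition graph_diff :: "'a ugraph \<Rightarrow> 'a ugraph \<Rightarrow> 'a ugraph" where
  "graph_diff G H = Graph (verts G) (edges G - edges H)"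

definition remove_verts :: "'a set \<Rightarrow> 'a ugraph \<Rightarrow> 'a ugraph" where
  "remove_verts S G = Graph (verts G - S) {e \<in> edges G. e \<inter> S = {}}"

section \<open>Connectivity\<close>

text \<open>As usual, the graph without vertices is not connected.\<close>

definition graph_connected :: "'a ugraph \<Rightarrow> bool" where
  "graph_connected G \<longleftrightarrow> verts G \<noteq> {} \<and>
     (\<forall>u\<in>verts G. \<forall>v\<in>verts G. (\<lambda>x y. {x, y} \<in> edges G)\<^sup>*\<^sup>* u v)"

definition k_connected :: "nat \<Rightarrow> 'a ugraph \<Rightarrow> bool" where
  "k_connected k G \<longleftrightarrow>
     (\<forall>S \<subseteq> verts G. finite S \<and> card S \<le> k - 1 \<longrightarrow> graph_connected (remove_verts S G))"

section \<open>The k-core\<close>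

inductive peel_step :: "nat \<Rightarrow> 'a ugraph \<Rightarrow> 'a ugraph \<Rightarrow> bool" for k where
  "v \<in> verts G \<Longrightarrow> deg G v < k \<Longrightarrow> peel_step k G (remove_verts {v} G)"

text \<open>
  Vertices of degree less than \<open>k\<close> are removed one at a time, in any order, until none is
  left.  For finite graphs the outcome exists and does not depend on the order; see
  \<open>k_core_ex1\<close> below.
\<close>

definition is_k_core :: "nat \<Rightarrow> 'a ugraph \<Rightarrow> 'a ugraph \<Rightarrow> bool" where
  "is_k_core k G C \<longleftrightarrow> (peel_step k)\<^sup>*\<^sup>* G C \<and> (\<forall>v\<in>verts C. k \<le> deg C v)"

definition k_core :: "nat \<Rightarrow> 'a ugraph \<Rightarrow> 'a ugraph" where
  "k_core k G = (THE C. is_k_core k G C)"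

lemma peel_steps_remove_verts:
  assumes "(peel_step k)\<^sup>*\<^sup>* G D"
  shows "\<exists>S \<subseteq> verts G. D = remove_verts S G"
  using assms
proof (induction rule: rtranclp_induct)
  case base
  show ?case by (rule exI[of _ "{}"]) (simp add: remove_verts_def)
next
  case (step D E)
  then obtain S where S: "S \<subseteq> verts G" "D = remove_verts S G" by blast
  from step(2) obtain v where v: "v \<in> verts D" "E = remove_verts {v} D"
    by (auto elim: peel_step.cases)
  have "E = remove_verts (insert v S) G" "insert v S \<subseteq> verts G"
    using S v by (auto simp: remove_verts_def)
  then show ?case by blast
qed

lemma k_core_verts_subset:
  assumes fin: "finite (edges G)" and C: "is_k_core k G C"
    and D: "(peel_step k)\<^sup>*\<^sup>* G D"
  shows "verts C \<subseteq> verts D"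
  using D
proof (induction rule: rtranclp_induct)
  case base
  obtain S where "C = remove_verts S G"
    using C peel_steps_remove_verts unfolding is_k_core_def by blast
  then show ?case by (auto simp: remove_verts_def)
next
  case (step D E)
  obtain S where S: "S \<subseteq> verts G" "C = remove_verts S G"
    using C peel_steps_remove_verts unfolding is_k_core_def by blast
  obtain T where T: "T \<subseteq> verts G" "D = remove_verts T G"
    using step(1) peel_steps_remove_verts by blast
  from step(2) obtain v where v: "deg D v < k" "E = remove_verts {v} D"
    by (auto elim: peel_step.cases)
  have "T \<subseteq> S" using step(3) S T by (auto simp: remove_verts_def)
  then have "deg C v \<le> deg D v"
    unfolding deg_def using fin S T by (intro card_mono) (auto simp: remove_verts_def)
  then have "v \<notin> verts C" using v(1) C by (auto simp: is_k_core_def)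
  then show ?case using step(3) v(2) by (auto simp: remove_verts_def)
qed

lemma k_core_exists:
  assumes "finite (verts G)"
  shows "\<exists>C. is_k_core k G C"
  using assms
proof (induction "card (verts G)" arbitrary: G rule: less_induct)
  case less
  show ?case
  proof (cases "\<forall>v\<in>verts G. k \<le> deg G v")
    case True
    then show ?thesis unfolding is_k_core_def by blast
  next
    case False
    then obtain v where v: "v \<in> verts G" "deg G v < k" by auto
    have "verts (remove_verts {v} G) \<subset> verts G" using v by (auto simp: remove_verts_def)
    then obtain C where "is_k_core k (remove_verts {v} G) C"
      using less.hyps[OF psubset_card_mono[OF less.prems]] less.prems
      by (metis finite_subset psubset_imp_subset)
    then show ?thesis
      using peel_step.intros[OF v] unfolding is_k_core_def
      by (meson converse_rtranclp_into_rtranclp)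
  qed
qed

lemma k_core_ex1:
  assumes "finite (verts G)" "finite (edges G)"
  shows "\<exists>!C. is_k_core k G C"
proof -
  have "C = D" if C: "is_k_core k G C" and D: "is_k_core k G D" for C D
  proof -
    have C': "(peel_step k)\<^sup>*\<^sup>* G C" and D': "(peel_step k)\<^sup>*\<^sup>* G D"
      using C D by (simp_all add: is_k_core_def)
    from peel_steps_remove_verts[OF C'] obtain S
      where S: "S \<subseteq> verts G" "C = remove_verts S G" by blast
    from peel_steps_remove_verts[OF D'] obtain T
      where T: "T \<subseteq> verts G" "D = remove_verts T G" by blast
    have "verts C = verts D"
      using k_core_verts_subset[OF assms(2) C D'] k_core_verts_subset[OF assms(2) D C'] by simp
    then have "verts G - S = verts G - T"
      by (simp add: S(2) T(2) remove_verts_def)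
    then have "S = T" using S(1) T(1) by blast
    then show ?thesis using S(2) T(2) by simp
  qed
  with k_core_exists[OF assms(1)] show ?thesis by (rule ex_ex1I)
qed

lemma is_k_core_k_core:
  assumes "finite (verts G)" "finite (edges G)"
  shows "is_k_core k G (k_core k G)"
  unfolding k_core_def by (rule theI') (rule k_core_ex1[OF assms])

section \<open>Resilience\<close>

definition resilient :: "real \<Rightarrow> nat \<Rightarrow> ('a ugraph \<Rightarrow> bool) \<Rightarrow> 'a ugraph \<Rightarrow> bool" where
  "resilient \<alpha> k P G \<longleftrightarrow>
     (\<forall>H. spanning_subgraph H G \<and>
          (\<forall>v\<in>verts G. real (deg H v) \<le> \<alpha> * real (deg G v)) \<and>
          (\<forall>v\<in>verts G. k \<le> deg (graph_diff G H) v)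
        \<longrightarrow> P (graph_diff G H))"

text \<open>The notion of resilience is meant for monotone increasing properties.\<close>

lemma k_connected_mono:
  assumes "k_connected k H" "spanning_subgraph H G"
  shows "k_connected k G"
proof -
  have V: "verts H = verts G" and E: "edges H \<subseteq> edges G"
    using assms(2) by (simp_all add: spanning_subgraph_def)
  have "graph_connected (remove_verts S G)" if *: "graph_connected (remove_verts S H)" for S
  proof -
    let ?r = "\<lambda>G x y. {x, y} \<in> edges (remove_verts S G)"
    have "?r H \<le> ?r G" using E by (auto simp: remove_verts_def)
    then have "(?r H)\<^sup>*\<^sup>* \<le> (?r G)\<^sup>*\<^sup>*" by (rule rtranclp_mono)
    moreover have "verts (remove_verts S G) = verts (remove_verts S H)"
      by (simp add: V remove_verts_def)
    ultimately show ?thesis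
      using * predicate2D[OF \<open>(?r H)\<^sup>*\<^sup>* \<le> (?r G)\<^sup>*\<^sup>*\<close>]
      by (simp add: graph_connected_def)
  qed
  then show ?thesis using assms(1) by (simp add: k_connected_def V)
qed

section \<open>The random graph process\<close>

definition add_edge :: "'a set \<Rightarrow> 'a ugraph \<Rightarrow> 'a ugraph" where
  "add_edge e G = Graph (verts G) (insert e (edges G))"

text \<open>
  The joint distribution of \<open>[G\<^sub>0, \<dots>, G\<^sub>i]\<close> on the vertex set \<open>{1..n}\<close>.
  It is only meaningful for \<open>i \<le> n choose 2\<close>, since afterwards no edge is missing.
\<close>

primrec graph_process_upto :: "nat \<Rightarrow> nat \<Rightarrow> nat ugraph list pmf" where
  "graph_process_upto n 0 = return_pmf [Graph {1..n} {}]"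
| "graph_process_upto n (Suc i) =
     bind_pmf (graph_process_upto n i) (\<lambda>Gs.
       map_pmf (\<lambda>e. Gs @ [add_edge e (last Gs)])
         (pmf_of_set (complete_edges {1..n} - edges (last Gs))))"

definition graph_process :: "nat \<Rightarrow> nat ugraph list pmf" where
  "graph_process n = graph_process_upto n (n choose 2)"

end

theory Submission
  imports Defs "HOL-Real_Asymp.Real_Asymp"
begin

text \<open>
  Let \<open>m\<^sub>0 = (1 + \<epsilon>) / 6 * n * ln n\<close> and \<open>m\<^sub>1 = 40 * n * ln n\<close>, and call a vertex tiny if its
  degree at time \<open>m\<^sub>0\<close> is below \<open>\<delta> * ln n\<close>.  A fixed vertex is tiny with probability about
  \<open>n powr (- (1 + \<epsilon>) / 3)\<close>, so with high probability \<open>G\<close> at time \<open>m\<^sub>1\<close> has no vertex with three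
  tiny neighbours, no tiny vertex with two tiny neighbours and no triangle with two tiny vertices;
  this is inherited by all earlier times, which avoids a union bound over \<open>m\<close> that these
  polynomially small probabilities would not survive.  After time \<open>m\<^sub>1\<close> every vertex has degree
  at least \<open>m / n\<close>.

  The first vertex to be peeled off that is not tiny would have lost at most two neighbours by
  then, hence still have large degree; so the core contains all vertices that are not tiny.
  Suppose that deleting \<open>H\<close> and fewer than \<open>k\<close> vertices \<open>S\<close> separates \<open>A\<close> from \<open>B\<close>, where \<open>A\<close> is
  the smaller side.  If \<open>A\<close> has linear size, \<open>H\<close> contains all edges between \<open>A\<close> and \<open>B\<close>, that is
  about half of the degree sum of \<open>A\<close> or more, which is too much.  If \<open>A\<close> is small, then at least
  a fifth of its vertices are not tiny: a tiny vertex of \<open>A\<close> whose neighbours in \<open>A\<close> are all tiny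
  is adjacent to all of \<open>S\<close> and to a tiny vertex of \<open>A\<close>, and by the absence of triangles the
  latter cannot be of this type as well.  So \<open>A \<union> S\<close> spans more edges than any set of its size does.

  All tail bounds are Markov's inequality for \<open>\<Prod>e\<in>E. w e\<close>, whose expectation over a uniform
  \<open>m\<close>-set of edges is at most the \<open>m\<close>-th power of the mean weight (Maclaurin's inequality).
\<close>

section \<open>Resilience of the core of a pseudorandom graph\<close>

definition nbrs :: "'a set set \<Rightarrow> 'a \<Rightarrow> 'a set" where
  "nbrs E v = {u. {v, u} \<in> E}"

definition edges_between :: "'a set \<Rightarrow> 'a set \<Rightarrow> 'a set set" where
  "edges_between A B = (\<lambda>(a, b). {a, b}) ` (A \<times> B)"

lemma complete_edgesD:
  assumes "E \<subseteq> complete_edges V" "{x, y} \<in> E"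
  shows "x \<in> V" "y \<in> V" "x \<noteq> y"
  using assms by (auto simp: complete_edges_def card_2_iff)

lemma finite_complete_edges: "finite V \<Longrightarrow> finite (complete_edges V)"
  unfolding complete_edges_def by (rule finite_subset[of _ "Pow V"]) auto

lemma card_complete_edges: "finite V \<Longrightarrow> card (complete_edges V) = card V choose 2"
  unfolding complete_edges_def by (rule n_subsets)

lemma inj_on_edges_between: "A \<inter> B = {} \<Longrightarrow> inj_on (\<lambda>(a, b). {a, b}) (A \<times> B)"
  by (auto simp: inj_on_def doubleton_eq_iff)

lemma card_edges_between: "A \<inter> B = {} \<Longrightarrow> card (edges_between A B) = card A * card B"
  unfolding edges_between_def by (simp add: card_image inj_on_edges_between card_cartesian_product)

lemma nbrs_subset: "E \<subseteq> complete_edges V \<Longrightarrow> nbrs E v \<subseteq> V"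
  by (auto simp: nbrs_def dest: complete_edgesD)

lemma nbrs_mono: "E \<subseteq> F \<Longrightarrow> nbrs E v \<subseteq> nbrs F v"
  by (auto simp: nbrs_def)

lemma deg_eq_card_nbrs:
  assumes "edges G \<subseteq> complete_edges V"
  shows "deg G v = card (nbrs (edges G) v)"
proof -
  have "{e \<in> edges G. v \<in> e} = (\<lambda>u. {v, u}) ` nbrs (edges G) v"
  proof (intro equalityI subsetI)
    fix e assume e: "e \<in> {e \<in> edges G. v \<in> e}"
    then have "card e = 2" using assms by (auto simp: complete_edges_def)
    then obtain x y where "e = {x, y}" by (auto simp: card_2_iff)
    then show "e \<in> (\<lambda>u. {v, u}) ` nbrs (edges G) v"
      using e by (auto simp: nbrs_def insert_commute)
  qed (auto simp: nbrs_def)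
  moreover have "inj_on (\<lambda>u. {v, u}) (nbrs (edges G) v)"
    by (auto simp: inj_on_def doubleton_eq_iff)
  ultimately show ?thesis by (simp add: deg_def card_image)
qed

lemma sum_deg_eq:
  assumes "finite A" "finite (edges G)"
  shows "(\<Sum>v\<in>A. deg G v) = (\<Sum>e\<in>edges G. card (e \<inter> A))"
proof -
  have "(\<Sum>v\<in>A. deg G v) = (\<Sum>v\<in>A. \<Sum>e\<in>edges G. if v \<in> e then 1 else 0)"
    unfolding deg_def using assms by (simp add: sum.If_cases Int_def)
  also have "\<dots> = (\<Sum>e\<in>edges G. \<Sum>v\<in>A. if v \<in> e then 1 else 0)"
    by (rule sum.swap)
  also have "\<dots> = (\<Sum>e\<in>edges G. card (e \<inter> A))"
    using assms by (intro sum.cong refl) (simp add: sum.If_cases Int_commute)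
  finally show ?thesis .
qed

lemma card_Int_edges_between_le_sum_deg:
  assumes "finite A" "finite (edges G)"
  shows "card (edges G \<inter> edges_between A B) \<le> (\<Sum>v\<in>A. deg G v)"
proof -
  have "card (edges G \<inter> edges_between A B) = (\<Sum>e\<in>edges G \<inter> edges_between A B. 1)" by simp
  also have "\<dots> \<le> (\<Sum>e\<in>edges G \<inter> edges_between A B. card (e \<inter> A))"
    using assms by (intro sum_mono) (auto simp: edges_between_def Suc_le_eq card_gt_0_iff)
  also have "\<dots> \<le> (\<Sum>e\<in>edges G. card (e \<inter> A))"
    using assms by (intro sum_mono2) auto
  also have "\<dots> = (\<Sum>v\<in>A. deg G v)" by (rule sum_deg_eq[OF assms, symmetric])
  finally show ?thesis .
qed

lemma disconnected_partition:
  assumes fin: "finite (verts G)" and ne: "verts G \<noteq> {}"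
    and E: "edges G \<subseteq> complete_edges (verts G)" and nc: "\<not> graph_connected G"
  obtains A B where "A \<union> B = verts G" "A \<inter> B = {}" "A \<noteq> {}"
    "card A \<le> card B" "edges G \<inter> edges_between A B = {}"
proof -
  let ?r = "\<lambda>x y. {x, y} \<in> edges G"
  obtain u v where uv: "u \<in> verts G" "v \<in> verts G" "\<not> ?r\<^sup>*\<^sup>* u v"
    using nc ne by (auto simp: graph_connected_def)
  define A where "A = {x \<in> verts G. ?r\<^sup>*\<^sup>* u x}"
  define B where "B = verts G - A"
  have no: "{a, b} \<notin> edges G" if "a \<in> A" "b \<in> B" for a b
    using that by (auto simp: A_def B_def intro: rtranclp.rtrancl_into_rtrancl)
  have AB: "A \<union> B = verts G" "A \<inter> B = {}" "u \<in> A" "v \<in> B"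
    using uv by (auto simp: A_def B_def)
  have no1: "edges G \<inter> edges_between A B = {}" "edges G \<inter> edges_between B A = {}"
    using no by (auto simp: edges_between_def) (metis insert_commute)
  \<comment> \<open>\<open>A\<close> has to be the smaller side, so the class of \<open>u\<close>
    and its complement may have to trade places.\<close>
  show thesis
  proof (cases "card A \<le> card B")
    case True
    then show ?thesis using that[of A B] AB no1 by auto
  next
    case False
    then show ?thesis using that[of B A] AB no1 by auto
  qed
qed

section \<open>Cores and separations in the presence of tiny vertices\<close>

text \<open>Induction along the peeling, with the invariant that only vertices of \<open>T\<close>
  have been removed. A vertex outside \<open>T\<close> has then lost at most its two neighbours in
  \<open>T\<close>, so its degree is still at least \<open>k\<close> and it cannot be the next
  one.\<close>

lemma k_core_tiny:
  assumes fin: "finite (verts G)" and E: "edges G \<subseteq> complete_edges (verts G)"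
    and few: "\<And>v. v \<in> verts G \<Longrightarrow> card (nbrs (edges G) v \<inter> T) \<le> 2"
    and big: "\<And>v. v \<in> verts G - T \<Longrightarrow> k + 2 \<le> deg G v"
  shows "\<exists>Z. Z \<subseteq> T \<and> Z \<subseteq> verts G \<and> k_core k G = remove_verts Z G"
proof -
  have finE: "finite (edges G)"
    using E fin finite_complete_edges finite_subset by blast
  have core: "is_k_core k G (k_core k G)" using fin finE by (rule is_k_core_k_core)
  then have peel: "(peel_step k)\<^sup>*\<^sup>* G (k_core k G)" by (simp add: is_k_core_def)
  then obtain Z where Z: "Z \<subseteq> verts G" "k_core k G = remove_verts Z G"
    using peel_steps_remove_verts by blast
  have "verts G - T \<subseteq> verts (k_core k G)"
    using peel
  proof (induction rule: rtranclp_induct)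
    case (step D D')
    obtain Y where Y: "Y \<subseteq> verts G" "D = remove_verts Y G"
      using step(1) peel_steps_remove_verts by blast
    from step(2) obtain v where v: "v \<in> verts D" "deg D v < k" "D' = remove_verts {v} D"
      by (auto elim: peel_step.cases)
    have YT: "Y \<subseteq> T" using step(3) Y by (auto simp: remove_verts_def)
    have "v \<in> T"
    proof (rule ccontr)
      assume "v \<notin> T"
      then have vG: "v \<in> verts G - T" "v \<notin> Y" using v(1) Y YT by (auto simp: remove_verts_def)
      have ED: "edges D \<subseteq> complete_edges (verts G)" using E Y by (auto simp: remove_verts_def)
      have "nbrs (edges G) v \<subseteq> nbrs (edges D) v \<union> (nbrs (edges G) v \<inter> T)"
        using YT vG by (auto simp: Y(2) remove_verts_def nbrs_def)
      moreover have "finite (nbrs (edges D) v)" "finite (nbrs (edges G) v)"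
        using nbrs_subset[OF ED] nbrs_subset[OF E] fin by (meson finite_subset)+
      ultimately have "card (nbrs (edges G) v)
          \<le> card (nbrs (edges D) v) + card (nbrs (edges G) v \<inter> T)"
        by (meson card_Un_le card_mono finite_Int finite_Un le_trans)
      then show False
        using few[of v] big[OF vG(1)] v(2) vG
        by (simp add: deg_eq_card_nbrs[OF E] deg_eq_card_nbrs[OF ED])
    qed
    then show ?case using step(3) v(3) by (auto simp: remove_verts_def)
  qed simp
  then have "Z \<subseteq> T" using Z by (auto simp: remove_verts_def)
  then show ?thesis using Z by blast
qed

text \<open>The tiny vertices of \<open>A\<close> are charged to the others in two rounds. Those in
  \<open>T1\<close> have a non-tiny neighbour in \<open>A\<close>, and a vertex of \<open>A\<close>
  has at most two tiny neighbours, so \<open>T1\<close> is at most twice as large as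
  \<open>A - T\<close>. Those in \<open>T2\<close> have a neighbour in \<open>T1\<close>, and a tiny
  vertex has at most one tiny neighbour, so \<open>T2\<close> is at most as large as
  \<open>T1\<close>. In total this gives 1 + 2 + 2.\<close>

lemma card_le_five_times_nontiny:
  assumes k: "k \<ge> 2" and fin: "finite A" "finite S" "finite T" and disj: "A \<inter> S = {}"
    and S: "card S \<le> k - 1"
    and F: "F \<subseteq> E"
    and nb: "\<And>a. a \<in> A \<Longrightarrow> nbrs F a \<subseteq> A \<union> S" "\<And>a. a \<in> A \<Longrightarrow> k \<le> card (nbrs F a)"
    and D1: "\<And>v. v \<in> T \<Longrightarrow> card (nbrs E v \<inter> T) \<le> 1"
    and D2: "\<And>v. v \<in> A \<Longrightarrow> card (nbrs E v \<inter> T) \<le> 2"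
    and D3: "\<And>u v s. u \<in> T \<Longrightarrow> v \<in> T \<Longrightarrow> s \<in> S \<Longrightarrow> {u, v} \<in> E \<Longrightarrow> {u, s} \<in> E \<Longrightarrow> {v, s} \<in> E \<Longrightarrow> False"
  shows "card A \<le> 5 * card (A - T)"
proof -
  define T1 where "T1 = {t \<in> A \<inter> T. nbrs F t - T - S \<noteq> {}}"
  define T2 where "T2 = A \<inter> T - T1"
  \<comment> \<open>Of at least \<open>k\<close> neighbours at most \<open>k - 1\<close> lie in
    \<open>S\<close> and at most one is tiny, so both bounds are attained. \<open>S\<close> is
    nonempty because \<open>k\<close> is at least 2.\<close>
  have T2: "S \<subseteq> nbrs F t \<and> S \<noteq> {} \<and> (\<exists>t'. t' \<in> A \<inter> T \<and> t' \<in> nbrs F t)" if "t \<in> T2" for t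
  proof -
    have t: "t \<in> A" "t \<in> T" "nbrs F t \<subseteq> T \<union> S" using that by (auto simp: T2_def T1_def)
    have finF: "finite (nbrs F t)" using nb(1)[OF t(1)] fin by (meson finite_UnI finite_subset)
    have dec: "nbrs F t = (nbrs F t \<inter> T - S) \<union> (nbrs F t \<inter> S)" using t(3) by blast
    have "card (nbrs F t) = card (nbrs F t \<inter> T - S) + card (nbrs F t \<inter> S)"
      by (subst dec, rule card_Un_disjoint) (use finF in auto)
    moreover have "card (nbrs F t \<inter> T - S) \<le> card (nbrs E t \<inter> T)"
      using nbrs_mono[OF F] fin by (intro card_mono) auto
    moreover have "card (nbrs F t \<inter> S) \<le> card S" using fin by (intro card_mono) auto
    ultimately have eq: "card (nbrs F t \<inter> S) = card S" "card S = k - 1" "card (nbrs F t \<inter> T - S) \<ge> 1"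
      using D1[OF t(2)] nb(2)[OF t(1)] S k by linarith+
    have "S \<subseteq> nbrs F t" using eq(1) fin by (metis card_subset_eq inf.cobounded2 inf.absorb_iff2)
    moreover have "S \<noteq> {}" using eq(2) k by auto
    moreover have "nbrs F t \<inter> T - S \<noteq> {}" using eq(3) by (metis card.empty not_one_le_zero)
    ultimately show ?thesis using nb(1)[OF t(1)] by blast
  qed
  have "T1 \<subseteq> (\<Union>w\<in>A - T. nbrs E w \<inter> T)"
    using nb(1) F by (fastforce simp: T1_def nbrs_def insert_commute)
  then have "card T1 \<le> card (\<Union>w\<in>A - T. nbrs E w \<inter> T)" using fin by (intro card_mono) auto
  also have "\<dots> \<le> (\<Sum>w\<in>A - T. card (nbrs E w \<inter> T))" using fin by (intro card_UN_le) auto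
  also have "\<dots> \<le> (\<Sum>w\<in>A - T. 2)" using D2 by (intro sum_mono) auto
  finally have T1c: "card T1 \<le> 2 * card (A - T)" by simp
  have "T2 \<subseteq> (\<Union>w\<in>T1. nbrs E w \<inter> T)"
  proof
    fix t assume t: "t \<in> T2"
    from T2[OF t] obtain t' s where t': "t' \<in> A \<inter> T" "t' \<in> nbrs F t" and s: "s \<in> S" "s \<in> nbrs F t"
      by blast
    have tT: "t \<in> T" using t by (simp add: T2_def)
    \<comment> \<open>Otherwise \<open>t\<close> and \<open>t'\<close> would both be adjacent to
      \<open>s\<close>, which gives a triangle with two tiny vertices.\<close>
    have "t' \<in> T1"
    proof (rule ccontr)
      assume "t' \<notin> T1"
      then have "t' \<in> T2" using t' by (simp add: T2_def)
      then have "s \<in> nbrs F t'" using T2 s by blast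
      then show False using D3[OF tT _ s(1), of t'] t' s F by (auto simp: nbrs_def)
    qed
    then show "t \<in> (\<Union>w\<in>T1. nbrs E w \<inter> T)"
      using t' tT F by (auto simp: nbrs_def insert_commute)
  qed
  then have "card T2 \<le> card (\<Union>w\<in>T1. nbrs E w \<inter> T)" using fin by (intro card_mono) (auto simp: T1_def)
  also have "\<dots> \<le> (\<Sum>w\<in>T1. card (nbrs E w \<inter> T))" using fin by (intro card_UN_le) (auto simp: T1_def)
  also have "\<dots> \<le> (\<Sum>w\<in>T1. 1)" using D1 by (intro sum_mono) (auto simp: T1_def)
  finally have T2c: "card T2 \<le> card T1" by simp
  have "A = (A - T) \<union> (T1 \<union> T2)" by (auto simp: T1_def T2_def)
  then have "card A \<le> card (A - T) + (card T1 + card T2)"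
    by (metis add_left_mono card_Un_le le_trans)
  then show ?thesis using T1c T2c by linarith
qed

text \<open>The deterministic core of the argument. \<open>D\<close> bounds the degrees outside
  \<open>T\<close> from below, \<open>r\<close> stands for the average degree, \<open>\<xi>\<close>
  separates small from linear vertex sets and \<open>\<theta>\<close> is a relative error. A small
  separated side contradicts D5, a large one contradicts D7 and D8 together.\<close>

lemma core_resilient:
  fixes k :: nat and \<epsilon> \<theta> \<xi> D r :: real
  assumes k: "k \<ge> 2"
    and fin: "finite (verts G)" and E: "edges G \<subseteq> complete_edges (verts G)"
    and T: "T \<subseteq> verts G"
    and D1: "\<And>v. v \<in> T \<Longrightarrow> card (nbrs (edges G) v \<inter> T) \<le> 1"
    and D2: "\<And>v. v \<in> verts G \<Longrightarrow> card (nbrs (edges G) v \<inter> T) \<le> 2"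
    and D3: "\<And>u v s. u \<in> T \<Longrightarrow> v \<in> T \<Longrightarrow>
       {u, v} \<in> edges G \<Longrightarrow> {u, s} \<in> edges G \<Longrightarrow> {v, s} \<in> edges G \<Longrightarrow> False"
    and D4: "\<And>v. v \<in> verts G - T \<Longrightarrow> D \<le> deg G v" and D: "D \<ge> k + 4"
    and D5: "\<And>U. U \<subseteq> verts G \<Longrightarrow> U \<noteq> {} \<Longrightarrow> card U \<le> 2 * \<xi> * card (verts G) \<Longrightarrow>
       card {e \<in> edges G. e \<subseteq> U} < D / (40 * k) * card U"
    and D6: "card T \<le> \<xi> * card (verts G)"
    and D7: "\<And>A. A \<subseteq> verts G \<Longrightarrow> \<xi> * card (verts G) \<le> card A \<Longrightarrow>
       (\<Sum>v\<in>A. deg G v) \<le> (1 + \<theta>) * card A * r"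
    and D8: "\<And>A B. A \<subseteq> verts G \<Longrightarrow> B \<subseteq> verts G \<Longrightarrow> A \<inter> B = {} \<Longrightarrow>
       \<xi> * card (verts G) \<le> card A \<Longrightarrow> \<xi> * card (verts G) \<le> card B \<Longrightarrow>
       (1 - \<theta>) * card A * card B * r / card (verts G) \<le> card (edges G \<inter> edges_between A B)"
    and r: "r > 0" and \<xi>: "\<xi> > 0" "k \<le> \<xi> * card (verts G)"
    and par: "\<theta> > 0" "\<theta> + \<xi> < \<epsilon>" "\<epsilon> \<le> 1 / 4"
  shows "resilient (1 / 2 - \<epsilon>) k (k_connected k) (k_core k G)"
  unfolding resilient_def k_connected_def
proof (intro allI impI, elim conjE)
  fix H S
  let ?C = "k_core k G"
  let ?n = "real (card (verts G))"
  assume H: "spanning_subgraph H ?C"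
    and Hd: "\<forall>v\<in>verts ?C. real (deg H v) \<le> (1 / 2 - \<epsilon>) * real (deg ?C v)"
    and Hk: "\<forall>v\<in>verts ?C. k \<le> deg (graph_diff ?C H) v"
    and S: "S \<subseteq> verts (graph_diff ?C H)" "finite S" "card S \<le> k - 1"
  have "k + 2 \<le> deg G v" if "v \<in> verts G - T" for v
    using D4[OF that] D by linarith
  then obtain Z where Z: "Z \<subseteq> T" "Z \<subseteq> verts G" "?C = remove_verts Z G"
    using k_core_tiny[OF fin E D2] by blast
  have VC: "verts ?C = verts G - Z" by (simp add: Z remove_verts_def)
  have EC: "edges ?C \<subseteq> edges G" by (auto simp: Z remove_verts_def)
  have EC': "edges ?C \<subseteq> complete_edges (verts G)" using EC E by blast
  have ECV: "edges ?C \<subseteq> complete_edges (verts ?C)"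
    using E by (auto simp: VC complete_edges_def Z(3) remove_verts_def)
  have finE: "finite (edges G)" using E fin finite_complete_edges finite_subset by blast
  have VH: "verts H = verts ?C" and EH: "edges H \<subseteq> edges ?C"
    using H by (auto simp: spanning_subgraph_def)
  define F where "F = edges ?C - edges H"
  have FG: "F \<subseteq> edges G" using EC by (auto simp: F_def)
  have FV: "F \<subseteq> complete_edges (verts G)" using FG E by blast
  define R where "R = remove_verts S (graph_diff ?C H)"
  have VR: "verts R = verts G - Z - S" and ER: "edges R = {e \<in> F. e \<inter> S = {}}"
    by (auto simp: R_def remove_verts_def graph_diff_def VC F_def)
  have degF: "deg (graph_diff ?C H) v = card (nbrs F v)" for v
    using deg_eq_card_nbrs[of "graph_diff ?C H" "verts G" v] FV by (simp add: graph_diff_def F_def)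
  \<comment> \<open>Of \<open>T\<close> and \<open>S\<close>, each takes away at most the fraction
    \<open>\<xi>\<close> of the vertices.\<close>
  have cardV: "?n - \<xi> * ?n - \<xi> * ?n \<le> real (card (verts R))"
  proof -
    have "verts G \<subseteq> verts R \<union> (T \<union> S)" using Z by (auto simp: VR)
    then have "card (verts G) \<le> card (verts R \<union> (T \<union> S))"
      using fin S(2) T finite_subset by (intro card_mono) (auto simp: VR)
    also have "\<dots> \<le> card (verts R) + (card T + card S)"
      by (meson add_left_mono card_Un_le le_trans)
    finally show ?thesis using D6 \<xi>(2) S(3) by linarith
  qed
  have npos: "?n > 0" using \<xi> k by (metis of_nat_0_less_iff of_nat_le_iff order.strict_trans2 pos2 zero_less_mult_pos)
  have "graph_connected R"
  proof (rule ccontr)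
    assume nc: "\<not> graph_connected R"
    have "verts R \<noteq> {}"
    proof
      assume "verts R = {}"
      then have "(1 - 2 * \<xi>) * ?n \<le> 0" using cardV by (simp add: algebra_simps)
      then show False using npos par by (simp add: mult_le_0_iff)
    qed
    moreover have "finite (verts R)" using fin by (simp add: VR)
    moreover have "edges R \<subseteq> complete_edges (verts R)"
      using ECV by (auto simp: ER VR F_def VC complete_edges_def)
    ultimately obtain A B where AB: "A \<union> B = verts R" "A \<inter> B = {}" "A \<noteq> {}"
      "card A \<le> card B" "edges R \<inter> edges_between A B = {}"
      using disconnected_partition nc by metis
    have AV: "A \<subseteq> verts G" "B \<subseteq> verts G" using AB(1) by (auto simp: VR)
    have Afin: "finite A" using AV fin finite_subset by blast
    have Tfin: "finite T" using T fin finite_subset by blast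
    have AC: "A \<subseteq> verts ?C" "B \<subseteq> verts ?C" using AB(1) by (auto simp: VR VC)
    have AS: "A \<inter> S = {}" "B \<inter> S = {}" using AB(1) by (auto simp: VR)
    have nA: "nbrs F a \<subseteq> A \<union> S" if "a \<in> A" for a
    proof
      fix b assume b: "b \<in> nbrs F a"
      then have e: "{a, b} \<in> F" by (simp add: nbrs_def)
      show "b \<in> A \<union> S"
      proof (rule ccontr)
        assume n: "b \<notin> A \<union> S"
        have "b \<in> verts ?C" using e ECV by (auto simp: F_def complete_edges_def)
        then have "b \<in> B" using n AB(1) by (auto simp: VR VC)
        moreover have "{a, b} \<in> edges R" using e n that AS by (auto simp: ER)
        ultimately show False using AB(5) that by (auto simp: edges_between_def)
      qed
    qed
    have kA: "k \<le> card (nbrs F a)" if "a \<in> A" for a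
      using Hk that AC by (auto simp: degF)
    show False
    \<comment> \<open>The summand \<open>k - 1\<close> leaves room for \<open>S\<close>: in the
      small case local sparsity applies to \<open>A \<union> S\<close>. In the other case both sides
      have at least the fraction \<open>\<xi>\<close> of the vertices, as \<open>k\<close> itself is
      at most that number.\<close>
    proof (cases "real (card A + (k - 1)) \<le> 2 * \<xi> * ?n")
      case True
      define U where "U = A \<union> S"
      have five: "card A \<le> 5 * card (A - T)"
      proof (rule card_le_five_times_nontiny[OF k Afin S(2) Tfin AS(1) S(3) FG nA kA D1])
        show "card (nbrs (edges G) v \<inter> T) \<le> 2" if "v \<in> A" for v using D2 AV that by blast
        show False if "u \<in> T" "v \<in> T" "{u, v} \<in> edges G" "{u, s} \<in> edges G" "{v, s} \<in> edges G" for u v s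
          by (rule D3[OF that])
      qed
      have U: "U \<subseteq> verts G" "finite U" using AV S(1,2) Afin by (auto simp: U_def graph_diff_def VC)
      have cU: "card U = card A + card S"
        unfolding U_def by (rule card_Un_disjoint) (use Afin S AS in auto)
      have Apos: "card A \<ge> 1" using AB(3) Afin by (simp add: Suc_le_eq card_gt_0_iff)
      have "card U \<le> card A + (k - 1) * 1" using cU S(3) by simp
      also have "\<dots> \<le> card A + (k - 1) * card A" using Apos by (intro add_left_mono mult_left_mono) auto
      also have "\<dots> = k * card A" using k by (cases k) auto
      finally have cUk: "card U \<le> k * card A" .
      \<comment> \<open>At most two neighbours are missing from the core, and \<open>H\<close> takes
        at most half of the rest. (D - 2) / 2 is at least D / 4 because D is at least 4.\<close>
      have big: "D / 4 \<le> card (nbrs F a)" if a: "a \<in> A - T" for a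
      proof -
        have aC: "a \<in> verts ?C" using a AC by auto
        have "nbrs (edges G) a \<subseteq> nbrs (edges ?C) a \<union> (nbrs (edges G) a \<inter> T)"
          using Z a AC by (auto simp: nbrs_def remove_verts_def)
        moreover have "finite (nbrs (edges ?C) a)" "finite (nbrs (edges G) a)"
          using nbrs_subset[OF EC'] nbrs_subset[OF E] fin by (meson finite_subset)+
        ultimately have "card (nbrs (edges G) a) \<le> card (nbrs (edges ?C) a) + card (nbrs (edges G) a \<inter> T)"
          by (meson card_Un_le card_mono finite_Int finite_Un le_trans)
        then have 1: "D - 2 \<le> deg ?C a"
          using D4[of a] D2[of a] a AV by (auto simp: deg_eq_card_nbrs[OF E] deg_eq_card_nbrs[OF EC'])
        have EH': "edges H \<subseteq> complete_edges (verts G)" using EH EC' by blast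
        have "nbrs (edges ?C) a = nbrs F a \<union> nbrs (edges H) a"
          using EH by (auto simp: nbrs_def F_def)
        then have "deg ?C a \<le> card (nbrs F a) + deg H a"
          by (simp add: deg_eq_card_nbrs[OF EC'] deg_eq_card_nbrs[OF EH'] card_Un_le)
        moreover have "real (deg H a) \<le> (1 / 2 - \<epsilon>) * deg ?C a" using Hd aC by blast
        moreover have "(1 / 2 - \<epsilon>) * deg ?C a \<le> 1 / 2 * deg ?C a"
          using par \<xi>(1) by (intro mult_right_mono) auto
        ultimately show ?thesis using 1 D by linarith
      qed
      have "card (A - T) * (D / 4) = (\<Sum>a\<in>A - T. D / 4)" by simp
      also have "\<dots> \<le> (\<Sum>a\<in>A - T. real (deg (Graph (verts G) {e \<in> F. e \<subseteq> U}) a))"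
      proof (rule sum_mono)
        fix a assume a: "a \<in> A - T"
        have "nbrs F a = nbrs {e \<in> F. e \<subseteq> U} a"
          using nA a by (auto simp: nbrs_def U_def)
        moreover have "{e \<in> F. e \<subseteq> U} \<subseteq> complete_edges (verts G)" using FV by blast
        ultimately show "D / 4 \<le> real (deg (Graph (verts G) {e \<in> F. e \<subseteq> U}) a)"
          using big[OF a] deg_eq_card_nbrs[of "Graph (verts G) {e \<in> F. e \<subseteq> U}" "verts G" a] by simp
      qed
      also have "\<dots> = real (\<Sum>a\<in>A - T. deg (Graph (verts G) {e \<in> F. e \<subseteq> U}) a)" by simp
      also have "(\<Sum>a\<in>A - T. deg (Graph (verts G) {e \<in> F. e \<subseteq> U}) a) =
          (\<Sum>e\<in>{e \<in> F. e \<subseteq> U}. card (e \<inter> (A - T)))"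
        using sum_deg_eq[of "A - T" "Graph (verts G) {e \<in> F. e \<subseteq> U}"] Afin finE FG finite_subset by fastforce
      also have "\<dots> \<le> (\<Sum>e\<in>{e \<in> F. e \<subseteq> U}. 2)"
      proof (rule sum_mono)
        fix e assume "e \<in> {e \<in> F. e \<subseteq> U}"
        then have "card e = 2" using FV by (auto simp: complete_edges_def)
        then show "card (e \<inter> (A - T)) \<le> 2"
          by (metis card.infinite card_mono inf_le1 zero_neq_numeral)
      qed
      also have "\<dots> = 2 * card {e \<in> F. e \<subseteq> U}" by simp
      also have "\<dots> \<le> 2 * card {e \<in> edges G. e \<subseteq> U}"
        using finE FG by (intro mult_left_mono card_mono) auto
      finally have 1: "card (A - T) * (D / 4) \<le> 2 * card {e \<in> edges G. e \<subseteq> U}" by simp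
      \<comment> \<open>The constant 40 is 2 * 4 * 5: an edge may be counted from both ends, the
        degrees are at least D / 4, and \<open>A\<close> is at most five times \<open>A - T\<close>.
        The factor \<open>k\<close> pays for passing from \<open>A\<close> to
        \<open>U\<close>.\<close>
      have "card {e \<in> edges G. e \<subseteq> U} < D / (40 * k) * card U"
        by (rule D5) (use U AB(3) True cU S(3) in \<open>auto simp: U_def\<close>)
      also have "\<dots> \<le> D / (40 * k) * (k * card A)"
        using cUk D by (intro mult_left_mono) (auto simp flip: of_nat_mult)
      also have "\<dots> = D / 40 * card A" using k by simp
      also have "\<dots> \<le> D / 40 * (5 * card (A - T))"
        using five D by (intro mult_left_mono) auto
      finally show False using 1 by (simp add: mult.commute)
    next
      case False
      then have A\<xi>: "\<xi> * ?n \<le> card A" using \<xi>(2) by linarith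
      have B\<xi>: "\<xi> * ?n \<le> card B" using A\<xi> AB(4) by linarith
      \<comment> \<open>Both ends lie in the core and avoid \<open>S\<close>, so an edge that is not
        in \<open>H\<close> would join the two sides in \<open>R\<close>.\<close>
      have "edges G \<inter> edges_between A B \<subseteq> edges H \<inter> edges_between A B"
      proof
        fix e assume e: "e \<in> edges G \<inter> edges_between A B"
        then obtain a b where ab: "e = {a, b}" "a \<in> A" "b \<in> B" by (auto simp: edges_between_def)
        have "e \<in> edges ?C" using e ab AC by (auto simp: Z(3) remove_verts_def)
        moreover have "e \<notin> edges R" using AB(5) e by blast
        ultimately show "e \<in> edges H \<inter> edges_between A B" using e ab AS by (auto simp: ER F_def)
      qed
      moreover have finH: "finite (edges H)" using EH EC finE by (meson finite_subset)
      ultimately have "card (edges G \<inter> edges_between A B) \<le> card (edges H \<inter> edges_between A B)"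
        by (intro card_mono) auto
      also have "\<dots> \<le> (\<Sum>v\<in>A. deg H v)" by (rule card_Int_edges_between_le_sum_deg[OF Afin finH])
      finally have "real (card (edges G \<inter> edges_between A B)) \<le> (\<Sum>v\<in>A. real (deg H v))" by (simp flip: of_nat_sum)
      also have "\<dots> \<le> (\<Sum>v\<in>A. (1 / 2 - \<epsilon>) * real (deg G v))"
      proof (rule sum_mono)
        fix v assume v: "v \<in> A"
        have "deg ?C v \<le> deg G v" unfolding deg_def using EC finE by (intro card_mono) auto
        then have "(1 / 2 - \<epsilon>) * real (deg ?C v) \<le> (1 / 2 - \<epsilon>) * real (deg G v)"
          using par by (intro mult_left_mono) auto
        then show "real (deg H v) \<le> (1 / 2 - \<epsilon>) * real (deg G v)" using Hd v AC by fastforce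
      qed
      also have "\<dots> = (1 / 2 - \<epsilon>) * real (\<Sum>v\<in>A. deg G v)" by (simp add: sum_distrib_left)
      also have "\<dots> \<le> (1 / 2 - \<epsilon>) * ((1 + \<theta>) * card A * r)"
        using D7[OF AV(1) A\<xi>] par by (intro mult_left_mono) auto
      finally have "(1 - \<theta>) * card A * card B * r / ?n \<le> (1 / 2 - \<epsilon>) * ((1 + \<theta>) * card A * r)"
        using D8[OF AV AB(2) A\<xi> B\<xi>] by linarith
      then have "(card A * r) * ((1 - \<theta>) * card B) \<le> (card A * r) * ((1 / 2 - \<epsilon>) * (1 + \<theta>) * ?n)"
        using npos by (simp add: pos_divide_le_eq mult_ac)
      moreover have "real (card A) * r > 0" using AB(3) Afin r by (simp add: card_gt_0_iff)
      ultimately have 2: "(1 - \<theta>) * card B \<le> (1 / 2 - \<epsilon>) * (1 + \<theta>) * ?n"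
        by (simp only: mult_le_cancel_left_pos)
      have "real (card (verts R)) \<le> 2 * real (card B)"
        using card_Un_le[of A B] AB by simp
      then have "(1 - 2 * \<xi>) * ?n / 2 \<le> card B" using cardV by (simp add: algebra_simps)
      then have "(1 - \<theta>) * ((1 - 2 * \<xi>) * ?n / 2) \<le> (1 - \<theta>) * card B"
        using par \<xi>(1) by (intro mult_left_mono) auto
      also have "\<dots> \<le> (1 / 2 - \<epsilon>) * (1 + \<theta>) * ?n" by (rule 2)
      finally have "((1 - \<theta>) * (1 - 2 * \<xi>) / 2) * ?n \<le> ((1 / 2 - \<epsilon>) * (1 + \<theta>)) * ?n"
        by simp
      then have "(1 - \<theta>) * (1 - 2 * \<xi>) / 2 \<le> (1 / 2 - \<epsilon>) * (1 + \<theta>)"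
        by (simp only: mult_le_cancel_right_pos npos)
      \<comment> \<open>Comparing the two estimates for the cut leaves only the errors
        \<open>\<theta>\<close> and \<open>\<xi>\<close> to make up for \<open>\<epsilon>\<close>,
        and their sum is too small for that.\<close>
      then have "\<epsilon> + \<epsilon> * \<theta> + \<theta> * \<xi> \<le> \<theta> + \<xi>" by (simp add: field_simps)
      moreover have "\<epsilon> * \<theta> \<ge> 0" "\<theta> * \<xi> \<ge> 0" using par \<xi>(1) by auto
      ultimately show False using par by linarith
    qed
  qed
  then show "graph_connected (remove_verts S (graph_diff ?C H))" by (simp add: R_def)
qed

section \<open>Maclaurin's inequality and uniform subsets\<close>

lemma diff_mult_power_diff_nonneg:
  fixes u \<mu> :: real
  assumes "u \<ge> 0" "\<mu> \<ge> 0"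
  shows "(u - \<mu>) * (u ^ j - \<mu> ^ j) \<ge> 0"
proof (cases "u \<le> \<mu>")
  case True
  then have "u ^ j \<le> \<mu> ^ j" using assms by (intro power_mono) auto
  then show ?thesis using True by (simp add: mult_nonpos_nonpos)
next
  case False
  then have "\<mu> ^ j \<le> u ^ j" using assms by (intro power_mono) auto
  then show ?thesis using False by simp
qed

text \<open>Convexity of the power function: its tangent at \<open>u\<close>, evaluated at
  \<open>\<mu>\<close>, does not exceed the value there. It serves both Maclaurin's inequality and
  the supermartingale step for edge containment.\<close>

lemma power_tangent:
  fixes u \<mu> :: real
  assumes "u \<ge> 0" "\<mu> \<ge> 0"
  shows "real (Suc j) * \<mu> * u ^ j \<le> \<mu> ^ Suc j + real j * u ^ Suc j"
proof (induction j)
  case (Suc j)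
  have "u * (real (Suc j) * \<mu> * u ^ j) \<le> u * (\<mu> ^ Suc j + real j * u ^ Suc j)"
    using Suc assms(1) by (rule mult_left_mono)
  moreover have "(u - \<mu>) * (u ^ Suc j - \<mu> ^ Suc j) \<ge> 0"
    using assms by (rule diff_mult_power_diff_nonneg)
  ultimately show ?case by (simp add: algebra_simps)
qed simp

text \<open>The elementary symmetric polynomial of degree \<open>m\<close> in the weights.\<close>

definition esym :: "('a \<Rightarrow> real) \<Rightarrow> 'a set \<Rightarrow> nat \<Rightarrow> real" where
  "esym w S m = (\<Sum>E\<in>{E. E \<subseteq> S \<and> card E = m}. \<Prod>e\<in>E. w e)"

text \<open>Double counting of pairs consisting of a set and one of its elements.\<close>

lemma esym_Suc:
  assumes fin: "finite S"
  shows "real (Suc m) * esym w S (Suc m) = (\<Sum>x\<in>S. w x * esym w (S - {x}) m)"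
proof -
  let ?\<E> = "{E. E \<subseteq> S \<and> card E = Suc m}"
  have fE: "finite ?\<E>" by (rule finite_subset[of _ "Pow S"]) (use fin in auto)
  have "real (Suc m) * esym w S (Suc m) = (\<Sum>E\<in>?\<E>. \<Sum>x | x \<in> S \<and> x \<in> E. \<Prod>e\<in>E. w e)"
    unfolding esym_def sum_distrib_left
  proof (rule sum.cong[OF refl])
    fix E assume "E \<in> ?\<E>"
    moreover from this have "{x. x \<in> S \<and> x \<in> E} = E" by auto
    ultimately show "real (Suc m) * prod w E = (\<Sum>x | x \<in> S \<and> x \<in> E. \<Prod>e\<in>E. w e)" by simp
  qed
  also have "\<dots> = (\<Sum>x\<in>S. \<Sum>E | E \<in> ?\<E> \<and> x \<in> E. \<Prod>e\<in>E. w e)"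
    by (rule sum.swap_restrict[OF fE fin])
  also have "\<dots> = (\<Sum>x\<in>S. w x * esym w (S - {x}) m)"
  proof (rule sum.cong[OF refl])
    fix x assume x: "x \<in> S"
    have "(\<Sum>E | E \<in> ?\<E> \<and> x \<in> E. \<Prod>e\<in>E. w e) =
        (\<Sum>E | E \<subseteq> S - {x} \<and> card E = m. w x * (\<Prod>e\<in>E. w e))"
    proof (rule sum.reindex_bij_witness[where i = "insert x" and j = "\<lambda>E. E - {x}"])
      fix E assume E: "E \<in> {E. E \<in> ?\<E> \<and> x \<in> E}"
      then have "finite E" using fin finite_subset by auto
      then show "w x * prod w (E - {x}) = prod w E" using E prod.remove[of E x w] by simp
      show "E - {x} \<in> {E. E \<subseteq> S - {x} \<and> card E = m}" using E \<open>finite E\<close> by auto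
    next
      fix E assume E: "E \<in> {E. E \<subseteq> S - {x} \<and> card E = m}"
      then have "finite E" "x \<notin> E" using fin finite_subset by auto
      then show "insert x E \<in> {E. E \<in> ?\<E> \<and> x \<in> E}" using E x by auto
    qed auto
    then show "(\<Sum>E | E \<in> ?\<E> \<and> x \<in> E. \<Prod>e\<in>E. w e) = w x * esym w (S - {x}) m"
      by (simp add: esym_def sum_distrib_left)
  qed
  finally show ?thesis .
qed

text \<open>
  The induction draws the first element \<open>x\<close>.  Writing \<open>u\<close> for the average over the
  remaining elements, the resulting function of \<open>u\<close> lies below its tangent at the overall
  average \<open>\<mu>\<close>, and the linear terms cancel.
\<close>

lemma maclaurin_inequality:
  assumes "finite S" "\<And>x. x \<in> S \<Longrightarrow> w x \<ge> 0" "m \<le> card S"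
  shows "esym w S m \<le> real (card S choose m) * (sum w S / real (card S)) ^ m"
  using assms
proof (induction m arbitrary: S)
  case 0
  have "{E. E \<subseteq> S \<and> card E = 0} = {{}}" using 0(1) by (auto dest: finite_subset)
  then show ?case by (simp add: esym_def)
next
  case (Suc j S)
  define N where "N = card S"
  define \<mu> where "\<mu> = sum w S / N"
  define u where "u x = (sum w S - w x) / (real N - 1)" for x
  have N: "N \<ge> Suc j" using Suc.prems by (simp add: N_def)
  have W: "sum w S = N * \<mu>" using N by (simp add: \<mu>_def)
  have \<mu>0: "\<mu> \<ge> 0" unfolding \<mu>_def using Suc.prems by (intro divide_nonneg_nonneg sum_nonneg) auto
  have key: "(\<Sum>x\<in>S. w x * u x ^ j) \<le> N * \<mu> ^ Suc j"
  \<comment> \<open>For \<open>j = 0\<close> the set may be a singleton, and then \<open>u\<close>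
    would divide by zero.\<close>
  proof (cases "j = 0")
    case True
    then show ?thesis using W by simp
  next
    case False
    then have N2: "real N - 1 > 0" using N by auto
    have u0: "u x \<ge> 0" if "x \<in> S" for x
    proof -
      have "w x \<le> sum w S" using that Suc.prems by (intro member_le_sum) auto
      then show ?thesis using N2 by (simp add: u_def)
    qed
    have sumu: "(\<Sum>x\<in>S. u x - \<mu>) = 0"
    proof -
      have "(\<Sum>x\<in>S. u x) = (N * sum w S - sum w S) / (real N - 1)"
        by (simp add: u_def sum_divide_distrib[symmetric] sum_subtractf N_def)
      also have "\<dots> = sum w S" using N2 by (simp add: field_simps)
      finally show ?thesis using W by (simp add: sum_subtractf N_def)
    qed
    \<comment> \<open>The difference of the two sides is exactly the slack of
      \<open>power_tangent\<close> plus \<open>N - Suc j\<close> times the product in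
      \<open>diff_mult_power_diff_nonneg\<close>.\<close>
    have "w x * u x ^ j \<le> \<mu> ^ Suc j + (real (Suc j) - N) * \<mu> ^ j * (u x - \<mu>)" if x: "x \<in> S" for x
    proof -
      have wx: "w x = N * \<mu> - (real N - 1) * u x" using N2 W by (simp add: u_def)
      have "(real N - real (Suc j)) * ((u x - \<mu>) * (u x ^ j - \<mu> ^ j)) \<ge> 0"
        by (rule mult_nonneg_nonneg[OF _ diff_mult_power_diff_nonneg[OF u0[OF x] \<mu>0]]) (use N in simp)
      then show ?thesis
        unfolding wx using power_tangent[OF u0[OF x] \<mu>0, of j] by (simp add: algebra_simps)
    qed
    then have "(\<Sum>x\<in>S. w x * u x ^ j) \<le>
        (\<Sum>x\<in>S. \<mu> ^ Suc j + (real (Suc j) - N) * \<mu> ^ j * (u x - \<mu>))" by (rule sum_mono)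
    also have "\<dots> = N * \<mu> ^ Suc j + (real (Suc j) - N) * \<mu> ^ j * (\<Sum>x\<in>S. u x - \<mu>)"
      by (simp only: sum.distrib sum_distrib_left) (simp add: N_def)
    finally show ?thesis by (simp add: sumu)
  qed
  have "real (Suc j) * esym w S (Suc j) = (\<Sum>x\<in>S. w x * esym w (S - {x}) j)"
    by (rule esym_Suc[OF Suc.prems(1)])
  also have "\<dots> \<le> (\<Sum>x\<in>S. w x * (real (N - 1 choose j) * u x ^ j))"
  proof (intro sum_mono mult_left_mono)
    fix x assume x: "x \<in> S"
    have "real (N - 1) = real N - 1" using N by simp
    then show "esym w (S - {x}) j \<le> real (N - 1 choose j) * u x ^ j"
      using Suc.IH[of "S - {x}"] Suc.prems x N
      by (simp add: N_def u_def sum_diff1)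
    show "w x \<ge> 0" using Suc.prems x by auto
  qed
  also have "\<dots> = real (N - 1 choose j) * (\<Sum>x\<in>S. w x * u x ^ j)"
    by (simp add: sum_distrib_left mult_ac)
  also have "\<dots> \<le> real (N - 1 choose j) * (N * \<mu> ^ Suc j)"
    using key by (intro mult_left_mono) auto
  also have "\<dots> = real (Suc j) * (real (N choose Suc j) * \<mu> ^ Suc j)"
  proof -
    have "Suc j * (N choose Suc j) = N * (N - 1 choose j)"
      by (rule binomial_absorption)
    then have "real (Suc j) * real (N choose Suc j) = real N * real (N - 1 choose j)"
      by (metis of_nat_mult)
    then show ?thesis by (simp add: mult_ac)
  qed
  finally have "esym w S (Suc j) \<le> real (N choose Suc j) * \<mu> ^ Suc j"
    by (simp only: mult_le_cancel_left_pos of_nat_0_less_iff zero_less_Suc)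
  then show ?case by (simp add: N_def \<mu>_def)
qed

section \<open>Exponential moments of uniform sets of fixed size\<close>

definition m_subsets :: "'a set \<Rightarrow> nat \<Rightarrow> 'a set set" where
  "m_subsets K m = {E. E \<subseteq> K \<and> card E = m}"

lemma finite_m_subsets: "finite K \<Longrightarrow> finite (m_subsets K m)"
  unfolding m_subsets_def by (rule finite_subset[of _ "Pow K"]) auto

lemma card_m_subsets: "finite K \<Longrightarrow> card (m_subsets K m) = card K choose m"
  unfolding m_subsets_def by (rule n_subsets)

lemma m_subsets_nonempty: "finite K \<Longrightarrow> m \<le> card K \<Longrightarrow> m_subsets K m \<noteq> {}"
  by (metis card_m_subsets card.empty binomial_eq_0_iff not_le)

text \<open>Drawing with replacement would give the power of the mean weight exactly. Maclaurin's
  inequality makes it an upper bound for drawing without replacement; the rest is 1 + x \<le> exp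
  x.\<close>

lemma expectation_prod_m_subsets:
  fixes w :: "'a \<Rightarrow> real"
  assumes "finite K" "m \<le> card K" "\<And>e. e \<in> K \<Longrightarrow> w e \<ge> 0"
  shows "measure_pmf.expectation (pmf_of_set (m_subsets K m)) (\<lambda>E. \<Prod>e\<in>E. w e)
    \<le> exp (m * (\<Sum>e\<in>K. w e - 1) / card K)"
proof (cases "card K = 0")
  case True
  then show ?thesis using assms finite_m_subsets[of K m] m_subsets_nonempty[of K m]
    by (auto simp: integral_pmf_of_set m_subsets_def)
next
  case False
  have "measure_pmf.expectation (pmf_of_set (m_subsets K m)) (\<lambda>E. \<Prod>e\<in>E. w e)
      = esym w K m / real (card K choose m)"
    using assms finite_m_subsets[of K m] m_subsets_nonempty[of K m] card_m_subsets[of K m]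
    by (simp add: integral_pmf_of_set) (simp add: esym_def m_subsets_def)
  also have "\<dots> \<le> (sum w K / card K) ^ m"
    using maclaurin_inequality[OF assms(1,3,2)] assms(2)
    by (simp add: divide_le_eq mult.commute)
  also have "\<dots> \<le> exp ((\<Sum>e\<in>K. w e - 1) / card K) ^ m"
  proof (rule power_mono)
    have "sum w K / card K = 1 + (\<Sum>e\<in>K. w e - 1) / card K"
      using False by (simp add: sum_subtractf field_simps)
    then show "sum w K / card K \<le> exp ((\<Sum>e\<in>K. w e - 1) / card K)"
      by (simp add: exp_ge_add_one_self)
    show "0 \<le> sum w K / card K" using assms by (intro divide_nonneg_nonneg sum_nonneg) auto
  qed
  also have "\<dots> = exp (m * (\<Sum>e\<in>K. w e - 1) / card K)"
    by (simp flip: exp_of_nat_mult)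
  finally show ?thesis .
qed

text \<open>Markov's inequality for the exponential of the sum, which is the product of the weights
  \<open>exp (g e)\<close>.\<close>

lemma chernoff_m_subsets:
  fixes g :: "'a \<Rightarrow> real"
  assumes "finite K" "m \<le> card K"
  shows "measure_pmf.prob (pmf_of_set (m_subsets K m)) {E. s \<le> (\<Sum>e\<in>E. g e)}
    \<le> exp (m * (\<Sum>e\<in>K. exp (g e) - 1) / card K - s)"
proof -
  let ?p = "pmf_of_set (m_subsets K m)"
  have fin: "finite (set_pmf ?p)"
    using assms finite_m_subsets m_subsets_nonempty by (subst set_pmf_of_set) auto
  have "measure_pmf.prob ?p {E. s \<le> (\<Sum>e\<in>E. g e)} =
      measure_pmf.expectation ?p (indicator {E. s \<le> (\<Sum>e\<in>E. g e)})" by simp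
  also have "\<dots> \<le> measure_pmf.expectation ?p (\<lambda>E. exp (- s) * (\<Prod>e\<in>E. exp (g e)))"
  proof (rule integral_mono_AE)
    show "AE E in ?p. indicator {E. s \<le> (\<Sum>e\<in>E. g e)} E \<le> exp (- s) * (\<Prod>e\<in>E. exp (g e))"
    proof (rule AE_pmfI)
      fix E assume "E \<in> set_pmf ?p"
      then have "E \<in> m_subsets K m" using assms finite_m_subsets m_subsets_nonempty by (subst (asm) set_pmf_of_set) auto
      then have "finite E" using assms(1) by (auto simp: m_subsets_def dest: finite_subset)
      then have "exp (- s) * (\<Prod>e\<in>E. exp (g e)) = exp ((\<Sum>e\<in>E. g e) - s)"
        by (simp add: exp_sum exp_diff exp_minus field_simps)
      then show "indicator {E. s \<le> (\<Sum>e\<in>E. g e)} E \<le> exp (- s) * (\<Prod>e\<in>E. exp (g e))"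
        by (simp add: indicator_def)
    qed
  qed (auto intro: integrable_measure_pmf_finite[OF fin])
  also have "\<dots> \<le> exp (- s) * exp (m * (\<Sum>e\<in>K. exp (g e) - 1) / card K)"
    using expectation_prod_m_subsets[OF assms, of "\<lambda>e. exp (g e)"] by simp
  also have "\<dots> = exp (m * (\<Sum>e\<in>K. exp (g e) - 1) / card K - s)"
    by (simp flip: exp_add)
  finally show ?thesis .
qed

section \<open>Marginals of the random graph process\<close>

declare One_nat_def [simp del] \<comment> \<open>otherwise \<open>simp\<close> turns \<open>{1..n}\<close> into \<open>{Suc 0..n}\<close>\<close>

abbreviation kn :: "nat \<Rightarrow> nat set set" where
  "kn n \<equiv> complete_edges {1..n}"

lemma finite_kn: "finite (kn n)"
  by (simp add: finite_complete_edges)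

lemma card_kn: "card (kn n) = n choose 2"
  by (simp add: card_complete_edges)

lemma missing_edges:
  assumes "edges G \<subseteq> kn n" "card (edges G) = i" "i < n choose 2"
  shows "finite (kn n - edges G)" "kn n - edges G \<noteq> {}" "card (kn n - edges G) = (n choose 2) - i"
proof -
  show c: "card (kn n - edges G) = (n choose 2) - i"
    using assms finite_kn[of n] finite_subset by (subst card_Diff_subset) (auto simp: card_kn)
  show "finite (kn n - edges G)" using finite_kn by blast
  show "kn n - edges G \<noteq> {}" using c assms(3) by (metis card.empty less_numeral_extra(3) zero_less_diff)
qed

section \<open>Sure properties of runs and the distribution at a single time\<close>

text \<open>Collects what holds for every outcome of positive probability, so that arguments about
  single runs are free of probability.\<close>

definition is_run :: "nat \<Rightarrow> nat \<Rightarrow> nat ugraph list \<Rightarrow> bool" where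
  "is_run n i Gs \<longleftrightarrow> length Gs = Suc i \<and>
     (\<forall>j\<le>i. verts (Gs ! j) = {1..n} \<and> edges (Gs ! j) \<subseteq> kn n \<and> card (edges (Gs ! j)) = j) \<and>
     (\<forall>j j'. j \<le> j' \<longrightarrow> j' \<le> i \<longrightarrow> edges (Gs ! j) \<subseteq> edges (Gs ! j'))"

lemma is_runD:
  assumes "is_run n i Gs"
  shows "length Gs = Suc i" "j \<le> i \<Longrightarrow> verts (Gs ! j) = {1..n}" "j \<le> i \<Longrightarrow> edges (Gs ! j) \<subseteq> kn n"
    "j \<le> i \<Longrightarrow> card (edges (Gs ! j)) = j"
    "j \<le> j' \<Longrightarrow> j' \<le> i \<Longrightarrow> edges (Gs ! j) \<subseteq> edges (Gs ! j')"
  using assms by (auto simp: is_run_def)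

lemma is_run_last:
  assumes "is_run n i Gs"
  shows "last Gs = Gs ! i"
  using is_runD(1)[OF assms] by (metis last_conv_nth length_0_conv diff_Suc_1 nat.distinct(1))

lemma is_run_snoc:
  assumes run: "is_run n i Gs" and e: "e \<in> kn n - edges (last Gs)"
  shows "is_run n (Suc i) (Gs @ [add_edge e (last Gs)])"
proof -
  note D = is_runD[OF run]
  have fin: "finite (edges (Gs ! i))"
    by (rule finite_subset[OF D(3) finite_kn]) simp
  define Hs where "Hs = Gs @ [add_edge e (last Gs)]"
  have old: "Hs ! j = Gs ! j" if "j \<le> i" for j
    using that D(1) by (simp add: Hs_def nth_append)
  have new: "Hs ! Suc i = add_edge e (Gs ! i)"
    using D(1) is_run_last[OF run] by (simp add: Hs_def nth_append)
  have c: "card (edges (Hs ! Suc i)) = Suc i"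
    using e fin D(4)[of i] is_run_last[OF run] by (simp add: new add_edge_def)
  have sub: "edges (Hs ! j) \<subseteq> edges (Hs ! Suc i)" if "j \<le> i" for j
    using D(5)[of j i] that by (auto simp: old new add_edge_def)
  show ?thesis
    unfolding is_run_def Hs_def[symmetric]
  proof (intro conjI allI impI)
    show "length Hs = Suc (Suc i)" using D(1) by (simp add: Hs_def)
    fix j assume j: "j \<le> Suc i"
    show "verts (Hs ! j) = {1..n}"
      using j D(2)[of j] D(2)[of i] by (cases "j = Suc i") (auto simp: old new add_edge_def)
    show "edges (Hs ! j) \<subseteq> kn n"
      using j D(3)[of j] D(3)[of i] e by (cases "j = Suc i") (auto simp: old new add_edge_def)
    show "card (edges (Hs ! j)) = j"
      using j D(4)[of j] c by (cases "j = Suc i") (auto simp: old)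
  next
    fix j j' assume j: "j \<le> j'" "j' \<le> Suc i"
    show "edges (Hs ! j) \<subseteq> edges (Hs ! j')"
    proof (cases "j' = Suc i")
      case True
      then show ?thesis using sub[of j] j by (cases "j = Suc i") auto
    next
      case False
      then show ?thesis using j D(5)[of j j'] by (simp add: old)
    qed
  qed
qed

lemma is_run_upto:
  assumes "i \<le> n choose 2" "Gs \<in> set_pmf (graph_process_upto n i)"
  shows "is_run n i Gs"
  using assms
proof (induction i arbitrary: Gs)
  case 0
  then show ?case by (simp add: is_run_def)
next
  case (Suc i)
  then obtain Hs where Hs: "Hs \<in> set_pmf (graph_process_upto n i)"
    "Gs \<in> set_pmf (map_pmf (\<lambda>e. Hs @ [add_edge e (last Hs)]) (pmf_of_set (kn n - edges (last Hs))))"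
    by auto
  have run: "is_run n i Hs" using Suc Hs(1) by simp
  then have "edges (last Hs) \<subseteq> kn n" "card (edges (last Hs)) = i"
    by (auto simp: is_run_last) (auto simp: is_run_def)
  note m = missing_edges[OF this]
  have "Gs \<in> (\<lambda>e. Hs @ [add_edge e (last Hs)]) ` (kn n - edges (last Hs))"
    using Hs(2) m Suc.prems(1) by (simp add: set_pmf_of_set)
  then show ?case using is_run_snoc[OF run] by auto
qed

lemma finite_set_graph_process_upto:
  assumes "i \<le> n choose 2"
  shows "finite (set_pmf (graph_process_upto n i))"
  using assms
proof (induction i)
  case (Suc i)
  have "finite (set_pmf (map_pmf (\<lambda>e. Hs @ [add_edge e (last Hs)]) (pmf_of_set (kn n - edges (last Hs)))))"
    if "Hs \<in> set_pmf (graph_process_upto n i)" for Hs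
  proof -
    have run: "is_run n i Hs" using Suc that is_run_upto by simp
    then have "edges (last Hs) \<subseteq> kn n" "card (edges (last Hs)) = i"
      by (auto simp: is_run_last) (auto simp: is_run_def)
    note m = missing_edges[OF this]
    then show ?thesis using Suc.prems by simp
  qed
  then show ?case using Suc by simp
qed simp

text \<open>Later steps only append to the list. Hence events about early times can be evaluated in
  the process stopped there.\<close>

lemma take_graph_process_upto:
  assumes "j \<le> i" "i \<le> n choose 2"
  shows "map_pmf (take (Suc j)) (graph_process_upto n i) = graph_process_upto n j"
  using assms
proof (induction i rule: dec_induct)
  case base
  have "map_pmf (take (Suc j)) (graph_process_upto n j) = map_pmf (\<lambda>Gs. Gs) (graph_process_upto n j)"
    by (rule map_pmf_cong) (use is_run_upto[OF base] in \<open>auto simp: is_run_def\<close>)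
  then show ?case by simp
next
  case (step i)
  have "map_pmf (take (Suc j)) (graph_process_upto n (Suc i)) =
    graph_process_upto n i \<bind> (\<lambda>Gs. map_pmf (take (Suc j))
      (map_pmf (\<lambda>e. Gs @ [add_edge e (last Gs)]) (pmf_of_set (kn n - edges (last Gs)))))"
    by (simp add: map_bind_pmf)
  also have "\<dots> = graph_process_upto n i \<bind> (\<lambda>Gs. return_pmf (take (Suc j) Gs))"
  proof (rule bind_pmf_cong[OF refl])
    fix Gs assume "Gs \<in> set_pmf (graph_process_upto n i)"
    then have "length Gs = Suc i" using is_run_upto[of i n Gs] step by (simp add: is_run_def)
    then show "map_pmf (take (Suc j)) (map_pmf (\<lambda>e. Gs @ [add_edge e (last Gs)])
        (pmf_of_set (kn n - edges (last Gs)))) = return_pmf (take (Suc j) Gs)"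
      using step by (simp add: pmf.map_comp o_def map_pmf_const)
  qed
  also have "\<dots> = map_pmf (take (Suc j)) (graph_process_upto n i)"
    by (simp add: map_pmf_def)
  finally show ?case using step by simp
qed

lemma prob_graph_process_take:
  assumes "j \<le> n choose 2" "\<And>Gs. is_run n (n choose 2) Gs \<Longrightarrow> Gs \<in> A \<longleftrightarrow> take (Suc j) Gs \<in> B"
  shows "measure_pmf.prob (graph_process n) A = measure_pmf.prob (graph_process_upto n j) B"
proof -
  have "measure_pmf.prob (graph_process n) A = measure_pmf.prob (graph_process n) (take (Suc j) -` B)"
  proof (rule measure_pmf.finite_measure_eq_AE)
    show "AE Gs in graph_process n. Gs \<in> A \<longleftrightarrow> Gs \<in> take (Suc j) -` B"
      using assms(2) is_run_upto by (auto simp: graph_process_def intro!: AE_pmfI)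
  qed auto
  also have "\<dots> = measure_pmf.prob (map_pmf (take (Suc j)) (graph_process n)) B" by simp
  finally show ?thesis by (simp add: graph_process_def take_graph_process_upto assms)
qed

text \<open>Each edge set of size \<open>Suc i\<close> arises from exactly \<open>Suc i\<close>
  pairs of a predecessor and an added edge. As this number does not depend on the set, uniformity is
  passed on from step to step.\<close>

lemma edges_last_graph_process_upto:
  assumes "i \<le> n choose 2"
  shows "map_pmf (\<lambda>Gs. edges (last Gs)) (graph_process_upto n i) = pmf_of_set (m_subsets (kn n) i)"
  using assms
proof (induction i)
  case 0
  have "m_subsets (kn n) 0 = {{}}" using finite_kn by (auto simp: m_subsets_def dest: finite_subset)
  then show ?case by (simp add: pmf_of_set_singleton)
next
  case (Suc i)
  let ?N = "n choose 2"
  let ?S = "m_subsets (kn n)"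
  have S: "finite (?S j)" "j \<le> ?N \<Longrightarrow> ?S j \<noteq> {}" "card (?S j) = ?N choose j" for j
    using finite_m_subsets[OF finite_kn] m_subsets_nonempty[OF finite_kn] card_m_subsets[OF finite_kn]
    by (simp_all add: card_kn)
  have "map_pmf (\<lambda>Gs. edges (last Gs)) (graph_process_upto n (Suc i)) =
      map_pmf (\<lambda>Gs. edges (last Gs)) (graph_process_upto n i) \<bind>
        (\<lambda>E. map_pmf (\<lambda>e. insert e E) (pmf_of_set (kn n - E)))"
    by (simp add: map_bind_pmf bind_map_pmf pmf.map_comp o_def add_edge_def)
  also have "\<dots> = pmf_of_set (?S i) \<bind> (\<lambda>E. map_pmf (\<lambda>e. insert e E) (pmf_of_set (kn n - E)))"
    using Suc by simp
  also have "\<dots> = pmf_of_set (?S (Suc i))"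
  proof (rule pmf_eqI)
    fix E'
    have E: "finite (kn n - E)" "kn n - E \<noteq> {}" "card (kn n - E) = ?N - i" if "E \<in> ?S i" for E
      using missing_edges[of "Graph {} E" n i] that Suc.prems by (auto simp: m_subsets_def)
    have "pmf (pmf_of_set (?S i) \<bind> (\<lambda>E. map_pmf (\<lambda>e. insert e E) (pmf_of_set (kn n - E)))) E' =
        (\<Sum>E\<in>?S i. pmf (map_pmf (\<lambda>e. insert e E) (pmf_of_set (kn n - E))) E') / card (?S i)"
      using S Suc.prems by (subst pmf_bind_pmf_of_set) auto
    also have "(\<Sum>E\<in>?S i. pmf (map_pmf (\<lambda>e. insert e E) (pmf_of_set (kn n - E))) E') =
        (\<Sum>E\<in>?S i. card {e \<in> kn n - E. insert e E = E'} / (?N - i))"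
    proof (rule sum.cong[OF refl])
      fix E assume "E \<in> ?S i"
      note E = E[OF this]
      show "pmf (map_pmf (\<lambda>e. insert e E) (pmf_of_set (kn n - E))) E' =
          card {e \<in> kn n - E. insert e E = E'} / (?N - i)"
        using E by (simp add: pmf_map measure_pmf_of_set vimage_def Int_def)
    qed
    also have "\<dots> = real (\<Sum>E\<in>?S i. card {e \<in> kn n - E. insert e E = E'}) / (?N - i)"
      by (simp add: sum_divide_distrib)
    also have "(\<Sum>E\<in>?S i. card {e \<in> kn n - E. insert e E = E'}) =
        card (SIGMA E:?S i. {e \<in> kn n - E. insert e E = E'})"
      using S finite_kn by (subst card_SigmaI) auto
    also have "\<dots> = (if E' \<in> ?S (Suc i) then Suc i else 0)"
    proof (cases "E' \<in> ?S (Suc i)")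
      case True
      then have f: "finite E'" using finite_kn by (auto simp: m_subsets_def dest: finite_subset)
      have "bij_betw (\<lambda>e. (E' - {e}, e)) E' (SIGMA E:?S i. {e \<in> kn n - E. insert e E = E'})"
        using True f by (intro bij_betw_byWitness[where f' = snd]) (auto simp: m_subsets_def)
      then show ?thesis using True bij_betw_same_card by (fastforce simp: m_subsets_def)
    next
      case False
      have "insert e E \<in> ?S (Suc i)" if "E \<in> ?S i" "e \<in> kn n - E" for e E
        using that finite_kn[of n] finite_subset[of E "kn n"] by (auto simp: m_subsets_def)
      then have "(SIGMA E:?S i. {e \<in> kn n - E. insert e E = E'}) = {}" using False by auto
      then show ?thesis using False by (metis card.empty)
    qed
    also have "real (if E' \<in> ?S (Suc i) then Suc i else 0) / real (?N - i) / real (card (?S i)) =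
        indicator (?S (Suc i)) E' / card (?S (Suc i))"
    proof -
      \<comment> \<open>Pairs of an \<open>i\<close>-set and an element outside it, counted in two
        ways; this supplies the normalisation.\<close>
      have "(?N - i) * (?N choose i) = Suc i * (?N choose Suc i)"
        using Suc.prems by (metis binomial_absorb_comp binomial_absorption Suc_diff_1 diff_Suc_1 mult.commute)
      then have "real (?N - i) * real (?N choose i) = real (Suc i) * real (?N choose Suc i)"
        by (metis of_nat_mult)
      then have "real (Suc i) / real (?N - i) / real (?N choose i) =
          real (Suc i) / (real (Suc i) * real (?N choose Suc i))"
        by (simp only: divide_divide_eq_left)
      also have "\<dots> = 1 / real (?N choose Suc i)" by (simp del: of_nat_Suc)
      finally have "real (Suc i) / real (?N - i) / real (?N choose i) = 1 / real (?N choose Suc i)" .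
      then show ?thesis by (simp add: S(3) indicator_def)
    qed
    finally show "pmf (pmf_of_set (?S i) \<bind> (\<lambda>E. map_pmf (\<lambda>e. insert e E) (pmf_of_set (kn n - E)))) E' =
        pmf (pmf_of_set (?S (Suc i))) E'"
      using S Suc.prems by (subst pmf_of_set) auto
  qed
  finally show ?case .
qed

lemma prob_graph_process_edges:
  assumes "m \<le> n choose 2"
  shows "measure_pmf.prob (graph_process n) {Gs. P (edges (Gs ! m))} =
    measure_pmf.prob (pmf_of_set (m_subsets (kn n) m)) {E. P E}"
proof -
  have "measure_pmf.prob (graph_process n) {Gs. P (edges (Gs ! m))} =
      measure_pmf.prob (graph_process_upto n m) {Gs. P (edges (last Gs))}"
    using assms by (intro prob_graph_process_take) (auto simp: is_run_def take_Suc_conv_app_nth)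
  also have "\<dots> = measure_pmf.prob (map_pmf (\<lambda>Gs. edges (last Gs)) (graph_process_upto n m)) {E. P E}"
    by (simp add: vimage_def)
  finally show ?thesis by (simp add: edges_last_graph_process_upto assms)
qed

section \<open>Edges required to be present at a later time\<close>

text \<open>The form in which a supermartingale step is used: \<open>g\<close> bounds the
  conditional expectation of \<open>h\<close>. Finite supports reduce every expectation to a finite
  sum.\<close>

lemma expectation_bind_le:
  fixes h :: "'b \<Rightarrow> real"
  assumes "finite (set_pmf p)" "\<And>x. x \<in> set_pmf p \<Longrightarrow> finite (set_pmf (f x))"
    "\<And>x. x \<in> set_pmf p \<Longrightarrow> measure_pmf.expectation (f x) h \<le> g x"
  shows "measure_pmf.expectation (p \<bind> f) h \<le> measure_pmf.expectation p g"
proof -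
  have "measure_pmf.expectation (p \<bind> f) h = (\<Sum>a\<in>set_pmf p. pmf p a * measure_pmf.expectation (f a) h)"
    using assms by (subst pmf_expectation_bind[of "set_pmf p"]) auto
  also have "\<dots> \<le> (\<Sum>a\<in>set_pmf p. pmf p a * g a)"
    using assms by (intro sum_mono mult_left_mono) auto
  also have "\<dots> = measure_pmf.expectation p g"
    using assms by (subst integral_measure_pmf[of "set_pmf p"]) auto
  finally show ?thesis .
qed

text \<open>Of the \<open>D\<close> missing edges, \<open>card (F - E)\<close> lower the exponent.
  The relation between \<open>a\<close> and \<open>b\<close> makes the claim an equality when one
  edge of \<open>F\<close> is missing; for several missing edges \<open>power_tangent\<close>,
  applied at \<open>a\<close> and \<open>b\<close>, gives the inequality.\<close>

lemma containment_step:
  fixes F E K :: "'a set" and a b :: real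
  assumes "finite K" "E \<subseteq> K" "F \<subseteq> K" "card (K - E) = D" "D > 0" "a \<ge> 0" "b \<ge> 0"
    and ab: "D * b = 1 + (real D - 1) * a"
  shows "(\<Sum>e\<in>K - E. a ^ card (F - insert e E)) / D \<le> b ^ card (F - E)"
proof -
  let ?j = "card (F - E)"
  have fin: "finite (K - E)" "finite (F - E)" using assms finite_subset by blast+
  have sp: "K - E = (F - E) \<union> (K - E - F)" using assms by blast
  have "(\<Sum>e\<in>K - E. a ^ card (F - insert e E)) =
      (\<Sum>e\<in>F - E. a ^ card (F - insert e E)) + (\<Sum>e\<in>K - E - F. a ^ card (F - insert e E))"
    by (subst sp, rule sum.union_disjoint) (use fin in auto)
  also have "(\<Sum>e\<in>F - E. a ^ card (F - insert e E)) = (\<Sum>e\<in>F - E. a ^ (?j - 1))"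
  proof (rule sum.cong[OF refl])
    fix e assume "e \<in> F - E"
    moreover have "F - insert e E = (F - E) - {e}" by blast
    ultimately show "a ^ card (F - insert e E) = a ^ (?j - 1)" using fin by simp
  qed
  also have "(\<Sum>e\<in>K - E - F. a ^ card (F - insert e E)) = (\<Sum>e\<in>K - E - F. a ^ ?j)"
  proof (rule sum.cong[OF refl])
    fix e assume "e \<in> K - E - F"
    then have "F - insert e E = F - E" by blast
    then show "a ^ card (F - insert e E) = a ^ ?j" by simp
  qed
  also have "card (K - E - F) = D - ?j"
  proof -
    have "K - E - F = (K - E) - (F - E)" by blast
    then show ?thesis using assms fin by (simp add: card_Diff_subset Diff_mono)
  qed
  then have "(\<Sum>e\<in>K - E - F. a ^ ?j) = real (D - ?j) * a ^ ?j" by simp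
  also have "real (D - ?j) = real D - ?j"
    using assms card_mono[of "K - E" "F - E"] fin by (simp add: Diff_mono of_nat_diff)
  finally have sum: "(\<Sum>e\<in>K - E. a ^ card (F - insert e E)) =
      ?j * a ^ (?j - 1) + (real D - ?j) * a ^ ?j" by simp
  have "?j * a ^ (?j - 1) + (real D - ?j) * a ^ ?j \<le> D * b ^ ?j"
  proof (cases ?j)
    case (Suc i)
    show ?thesis
    proof (cases "b = 0")
      case True
      then have "1 + (real D - 1) * a = 0" using ab by simp
      moreover have "(real D - 1) * a \<ge> 0" using assms by (intro mult_nonneg_nonneg) auto
      ultimately show ?thesis by linarith
    next
      case False
      have "(real i + 1) * b * a ^ i * D \<le> (b ^ Suc i + i * a ^ Suc i) * D"
        using power_tangent[of a b i] assms by (intro mult_right_mono) (auto simp: add.commute)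
      moreover have "(real i + 1) * b * a ^ i * D = (real i + 1) * a ^ i * (D * b)" by simp
      ultimately have "(real i + 1) * a ^ i * (1 + (real D - 1) * a) \<le> (b ^ Suc i + i * a ^ Suc i) * D"
        by (simp only: ab)
      then show ?thesis by (simp add: Suc algebra_simps)
    qed
  qed simp
  then show ?thesis using assms by (simp add: sum divide_le_eq mult.commute)
qed

text \<open>
  The conditional probability that all missing edges of \<open>F\<close> show up by time \<open>M\<close> is
  dominated by the supermartingale \<open>((M - i) / (N - i)) ^ card (F - E\<^sub>i)\<close>.
\<close>

lemma prob_edges_before_le:
  fixes F :: "nat set set"
  assumes F: "F \<subseteq> kn n" and m: "m \<le> M" "M \<le> n choose 2"
  shows "measure_pmf.prob (graph_process n) {Gs. F \<subseteq> edges (Gs ! M) \<and> Q (edges (Gs ! m))} \<le>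
    measure_pmf.expectation (pmf_of_set (m_subsets (kn n) m))
      (\<lambda>E. indicator {E. Q E} E * ((real M - m) / (real (n choose 2) - m)) ^ card (F - E))"
proof -
  let ?N = "n choose 2"
  \<comment> \<open>The conditional probability that an edge missing at time \<open>i\<close> is
    present at time \<open>M\<close>.\<close>
  define a where "a i = (real M - real i) / (real ?N - real i)" for i
  define h where "h i Gs = indicator {E. Q E} (edges (Gs ! m)) * a i ^ card (F - edges (last Gs))" for i Gs
  let ?P = "graph_process_upto n"
  have finP: "finite (set_pmf (?P i))" if "i \<le> M" for i
    using that m by (intro finite_set_graph_process_upto) auto
  have "measure_pmf.expectation (?P i) (h i) \<le> measure_pmf.expectation (?P m) (h m)"
    if "m \<le> i" "i \<le> M" for i
    using that
  proof (induction i rule: dec_induct)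
    case (step i)
    have "measure_pmf.expectation (?P (Suc i)) (h (Suc i)) \<le> measure_pmf.expectation (?P i) (h i)"
      unfolding graph_process_upto.simps
    proof (rule expectation_bind_le)
      show "finite (set_pmf (?P i))" using step finP by simp
      fix Gs assume "Gs \<in> set_pmf (?P i)"
      then have run: "is_run n i Gs" using step m is_run_upto by simp
      then have E: "edges (last Gs) \<subseteq> kn n" "card (edges (last Gs)) = i"
        by (auto simp: is_run_last) (auto simp: is_run_def)
      have iN: "i < ?N" using step m by simp
      note ms = missing_edges[OF E iN]
      show "finite (set_pmf (map_pmf (\<lambda>e. Gs @ [add_edge e (last Gs)]) (pmf_of_set (kn n - edges (last Gs)))))"
        using ms by simp
      have nth: "(Gs @ [x]) ! m = Gs ! m" for x
        using run step by (simp add: is_run_def nth_append)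
      let ?I = "indicator {E. Q E} (edges (Gs ! m)) :: real"
      have "measure_pmf.expectation (map_pmf (\<lambda>e. Gs @ [add_edge e (last Gs)])
            (pmf_of_set (kn n - edges (last Gs)))) (h (Suc i)) =
          ?I * ((\<Sum>e\<in>kn n - edges (last Gs). a (Suc i) ^ card (F - insert e (edges (last Gs)))) / (?N - i))"
        using ms by (simp add: integral_pmf_of_set h_def nth add_edge_def sum_distrib_left[symmetric])
      also have "\<dots> \<le> ?I * a i ^ card (F - edges (last Gs))"
      proof (rule mult_left_mono)
        have aSuc: "(real (?N - i) - 1) * a (Suc i) = real M - real (Suc i)"
        \<comment> \<open>At the very last step \<open>a (Suc i)\<close> is 0 / 0, which is 0 by
          convention, and both sides vanish.\<close>
        proof (cases "Suc i = ?N")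
          case True
          then have "M = Suc i" "real (?N - i) = 1" using step(2,4) m(2) iN by (auto simp: of_nat_diff)
          then show ?thesis by simp
        next
          case False
          then have nz: "real ?N - real (Suc i) \<noteq> 0" by linarith
          have eq: "real (?N - i) - 1 = real ?N - real (Suc i)" using iN by (simp add: of_nat_diff)
          show ?thesis unfolding a_def eq using nz by (metis nonzero_mult_div_cancel_left times_divide_eq_right)
        qed
        have nz: "real ?N - real i \<noteq> 0" using iN by linarith
        have eq: "real (?N - i) = real ?N - real i" using iN by (simp add: of_nat_diff)
        have ai: "real (?N - i) * a i = real M - real i"
          unfolding a_def eq using nz by (metis nonzero_mult_div_cancel_left times_divide_eq_right)
        show "(\<Sum>e\<in>kn n - edges (last Gs). a (Suc i) ^ card (F - insert e (edges (last Gs)))) / (?N - i)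
            \<le> a i ^ card (F - edges (last Gs))"
        proof (rule containment_step[OF finite_kn E(1) F ms(3)])
          show "0 \<le> a (Suc i)" "0 \<le> a i" using step m iN by (auto simp: a_def)
          show "real (?N - i) * a i = 1 + (real (?N - i) - 1) * a (Suc i)"
            unfolding aSuc ai by simp
        qed (use iN in simp)
      qed simp
      finally show "measure_pmf.expectation (map_pmf (\<lambda>e. Gs @ [add_edge e (last Gs)])
          (pmf_of_set (kn n - edges (last Gs)))) (h (Suc i)) \<le> h i Gs"
        by (simp add: h_def)
    qed
    then show ?case using step by simp
  qed simp
  then have mono: "measure_pmf.expectation (?P M) (h M) \<le> measure_pmf.expectation (?P m) (h m)"
    using m by simp
  have "measure_pmf.prob (graph_process n) {Gs. F \<subseteq> edges (Gs ! M) \<and> Q (edges (Gs ! m))} =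
      measure_pmf.prob (?P M) {Gs. F \<subseteq> edges (last Gs) \<and> Q (edges (Gs ! m))}"
    using m by (intro prob_graph_process_take) (auto simp: is_run_def take_Suc_conv_app_nth nth_append)
  also have "\<dots> = measure_pmf.expectation (?P M) (indicator {Gs. F \<subseteq> edges (last Gs) \<and> Q (edges (Gs ! m))})"
    by simp
  also have "\<dots> = measure_pmf.expectation (?P M) (h M)"
  proof (rule integral_cong_AE)
    have "finite F" using F finite_kn finite_subset by blast
    then have "card (F - E) = 0 \<longleftrightarrow> F \<subseteq> E" for E by simp
    \<comment> \<open>At time \<open>M\<close> the base \<open>a M\<close> is 0, and 0 ^ 0 = 1 turns
      the power into the indicator of containment.\<close>
    then have "(0::real) ^ card (F - E) = (if F \<subseteq> E then 1 else 0)" for E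
      by (simp add: power_0_left)
    then show "AE Gs in ?P M. indicator {Gs. F \<subseteq> edges (last Gs) \<and> Q (edges (Gs ! m))} Gs = h M Gs"
      by (intro AE_pmfI) (simp add: h_def a_def indicator_def)
  qed auto
  also have "\<dots> \<le> measure_pmf.expectation (?P m) (h m)" by (rule mono)
  also have "measure_pmf.expectation (?P m) (h m) = measure_pmf.expectation (?P m)
      (\<lambda>Gs. indicator {E. Q E} (edges (last Gs)) * a m ^ card (F - edges (last Gs)))"
  proof (rule integral_cong_AE)
    show "AE Gs in ?P m. h m Gs = indicator {E. Q E} (edges (last Gs)) * a m ^ card (F - edges (last Gs))"
    proof (rule AE_pmfI)
      fix Gs assume "Gs \<in> set_pmf (?P m)"
      then have "last Gs = Gs ! m" using is_run_upto[of m n Gs] is_run_last m by simp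
      then show "h m Gs = indicator {E. Q E} (edges (last Gs)) * a m ^ card (F - edges (last Gs))"
        by (simp add: h_def)
    qed
  qed auto
  also have "\<dots> = measure_pmf.expectation (map_pmf (\<lambda>Gs. edges (last Gs)) (?P m))
      (\<lambda>E. indicator {E. Q E} E * a m ^ card (F - E))" by simp
  also have "map_pmf (\<lambda>Gs. edges (last Gs)) (?P m) = pmf_of_set (m_subsets (kn n) m)"
    using m by (intro edges_last_graph_process_upto) simp
  finally show ?thesis by (simp add: a_def)
qed

section \<open>Tail bounds\<close>

lemma real_choose_two: "real (n choose 2) = real n * (real n - 1) / 2"
proof (cases n)
  case (Suc k)
  have "even (n * (n - 1))" by (cases "even n") (auto simp: Suc)
  then have "real (n * (n - 1) div 2) = real (n * (n - 1)) / 2" by (simp add: real_of_nat_div)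
  then show ?thesis by (simp add: choose_two Suc algebra_simps)
qed simp

lemma edges_between_subset_kn:
  assumes "A \<subseteq> {1..n}" "B \<subseteq> {1..n}" "A \<inter> B = {}"
  shows "edges_between A B \<subseteq> kn n"
proof
  fix e assume "e \<in> edges_between A B"
  then obtain a b where "e = {a, b}" "a \<in> A" "b \<in> B" by (auto simp: edges_between_def)
  moreover have "a \<noteq> b" using calculation assms by auto
  ultimately show "e \<in> kn n" using assms by (auto simp: complete_edges_def)
qed

lemma exp_minus_le: "exp (- x) \<le> 1 - x + x\<^sup>2" if "0 \<le> x" for x :: real
proof (cases "x \<le> 1")
  case True
  have "1 \<le> (1 - x + x\<^sup>2) * (1 + x)"
  proof -
    have "(1 - x + x\<^sup>2) * (1 + x) = 1 + x ^ 3" by (simp add: algebra_simps power2_eq_square power3_eq_cube)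
    then show ?thesis using that by simp
  qed
  also have "\<dots> \<le> (1 - x + x\<^sup>2) * exp x"
    using that True by (intro mult_left_mono exp_ge_add_one_self) auto
  finally show ?thesis by (simp add: exp_minus field_simps)
next
  case False
  then have "x * 1 \<le> x * x" by (intro mult_left_mono) auto
  moreover have "exp (- x) \<le> 1" using that by simp
  ultimately show ?thesis unfolding power2_eq_square by linarith
qed

lemma set_pmf_m_subsets:
  "m \<le> n choose 2 \<Longrightarrow> set_pmf (pmf_of_set (m_subsets (kn n) m)) = m_subsets (kn n) m"
  using finite_m_subsets[OF finite_kn] m_subsets_nonempty[OF finite_kn]
  by (intro set_pmf_of_set) (auto simp: card_kn)

lemma finite_m_subset_kn: "E \<in> m_subsets (kn n) m \<Longrightarrow> finite E"
  by (auto simp: m_subsets_def intro: finite_subset[OF _ finite_kn])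

text \<open>The next three tail bounds differ only in the weight function \<open>g\<close> that
  detects the event.\<close>

lemma prob_graph_process_chernoff:
  fixes g :: "nat set \<Rightarrow> real" and s :: real
  assumes m: "m \<le> n choose 2" and P: "\<And>E. finite E \<Longrightarrow> P E \<Longrightarrow> s \<le> (\<Sum>e\<in>E. g e)"
  shows "measure_pmf.prob (graph_process n) {Gs. P (edges (Gs ! m))} \<le>
    exp (m * (\<Sum>e\<in>kn n. exp (g e) - 1) / (n choose 2) - s)"
proof -
  let ?p = "pmf_of_set (m_subsets (kn n) m)"
  have "measure_pmf.prob (graph_process n) {Gs. P (edges (Gs ! m))} = measure_pmf.prob ?p {E. P E}"
    by (rule prob_graph_process_edges[OF m])
  also have "\<dots> \<le> measure_pmf.prob ?p {E. s \<le> (\<Sum>e\<in>E. g e)}"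
  proof (rule measure_pmf.finite_measure_mono_AE)
    show "AE E in ?p. E \<in> {E. P E} \<longrightarrow> E \<in> {E. s \<le> (\<Sum>e\<in>E. g e)}"
      using P finite_m_subset_kn set_pmf_m_subsets[OF m] by (intro AE_pmfI) auto
  qed simp
  also have "\<dots> \<le> exp (m * (\<Sum>e\<in>kn n. exp (g e) - 1) / card (kn n) - s)"
    using m by (intro chernoff_m_subsets finite_kn) (simp add: card_kn)
  finally show ?thesis by (simp add: card_kn)
qed

text \<open>The weight \<open>- l\<close> on \<open>X\<close> turns the lower tail into an upper
  one. The mean number of edges in \<open>X\<close> is \<open>m * card X / (n choose 2)\<close>, and
  the callers choose \<open>l\<close>.\<close>

lemma prob_lower_tail:
  fixes l s :: real
  assumes X: "X \<subseteq> kn n" and m: "m \<le> n choose 2" and l: "l \<ge> 0"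
  shows "measure_pmf.prob (graph_process n) {Gs. real (card (edges (Gs ! m) \<inter> X)) \<le> s}
    \<le> exp (l * s - m * (l - l\<^sup>2) * card X / (n choose 2))"
proof -
  let ?K = "kn n"
  define g where "g e = (if e \<in> X then - l else 0)" for e
  have "measure_pmf.prob (graph_process n) {Gs. real (card (edges (Gs ! m) \<inter> X)) \<le> s} \<le>
      exp (m * (\<Sum>e\<in>?K. exp (g e) - 1) / (n choose 2) - (- l * s))"
  proof (rule prob_graph_process_chernoff[OF m])
    fix E :: "nat set set" assume E: "finite E" "real (card (E \<inter> X)) \<le> s"
    have "(\<Sum>e\<in>E. g e) = - l * card (E \<inter> X)"
      using E(1) by (simp add: g_def sum.If_cases Int_def)
    then show "- l * s \<le> (\<Sum>e\<in>E. g e)" using E(2) l by (simp add: mult_left_mono)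
  qed
  also have "\<dots> \<le> exp (l * s - m * (l - l\<^sup>2) * card X / (n choose 2))"
  proof -
    have "(\<Sum>e\<in>?K. exp (g e) - 1) \<le> (\<Sum>e\<in>?K. if e \<in> X then - (l - l\<^sup>2) else 0)"
      using exp_minus_le[OF l] by (intro sum_mono) (simp add: g_def)
    also have "\<dots> = - (l - l\<^sup>2) * card X"
      using X by (simp add: sum.If_cases finite_kn Int_absorb1)
    finally have "m * (\<Sum>e\<in>?K. exp (g e) - 1) / (n choose 2) \<le> m * (- (l - l\<^sup>2) * card X) / (n choose 2)"
      by (intro divide_right_mono mult_left_mono) auto
    also have "\<dots> = - (m * (l - l\<^sup>2) * card X / (n choose 2))"
      by (simp only: mult_minus_left mult_minus_right minus_divide_left mult.assoc)
    finally show ?thesis by simp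
  qed
  finally show ?thesis .
qed

lemma sum_card_Int_kn:
  assumes "A \<subseteq> {1..n}"
  shows "(\<Sum>e\<in>kn n. card (e \<inter> A)) = card A * (n - 1)"
proof -
  have fin: "finite A" using finite_subset[OF assms] by simp
  have "(\<Sum>e\<in>kn n. card (e \<inter> A)) = (\<Sum>v\<in>A. deg (Graph {1..n} (kn n)) v)"
    using sum_deg_eq[OF fin, of "Graph {1..n} (kn n)"] finite_kn by simp
  also have "\<dots> = (\<Sum>v\<in>A. n - 1)"
  proof (rule sum.cong[OF refl])
    fix v assume v: "v \<in> A"
    have "nbrs (kn n) v = {1..n} - {v}"
      using v assms by (auto simp: nbrs_def complete_edges_def card_2_iff doubleton_eq_iff)
    then show "deg (Graph {1..n} (kn n)) v = n - 1"
      using deg_eq_card_nbrs[of "Graph {1..n} (kn n)" "{1..n}" v] v assms by auto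
  qed
  finally show ?thesis by simp
qed

text \<open>An edge weighs \<open>l\<close> for each endpoint in \<open>A\<close>, so edges inside
  \<open>A\<close> count twice, as they do in the degree sum. The bound \<open>l \<le> 1 / 2\<close>
  keeps all weights at most 1, where exp x is at most 1 + x + x ^ 2.\<close>

lemma prob_sum_deg:
  fixes l s :: real
  assumes A: "A \<subseteq> {1..n}" and m: "m \<le> n choose 2" and n: "n \<ge> 2" and l: "0 \<le> l" "l \<le> 1 / 2"
  shows "measure_pmf.prob (graph_process n) {Gs. s \<le> real (\<Sum>v\<in>A. deg (Gs ! m) v)}
    \<le> exp (m * (l + 2 * l\<^sup>2) * (2 * card A / n) - l * s)"
proof -
  let ?K = "kn n"
  have finA: "finite A" using finite_subset[OF A] by simp
  define g where "g e = l * card (e \<inter> A)" for e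
  have "measure_pmf.prob (graph_process n) {Gs. s \<le> real (\<Sum>v\<in>A. deg (Gs ! m) v)} =
      measure_pmf.prob (graph_process n) {Gs. s \<le> real (\<Sum>v\<in>A. card {e \<in> edges (Gs ! m). v \<in> e})}"
    by (simp add: deg_def)
  also have "\<dots> \<le> exp (m * (\<Sum>e\<in>?K. exp (g e) - 1) / (n choose 2) - l * s)"
  proof (rule prob_graph_process_chernoff[OF m])
    fix E :: "nat set set" assume E: "finite E" "s \<le> real (\<Sum>v\<in>A. card {e \<in> E. v \<in> e})"
    have "(\<Sum>e\<in>E. g e) = l * real (\<Sum>v\<in>A. card {e \<in> E. v \<in> e})"
      using sum_deg_eq[OF finA, of "Graph {} E"] E(1) by (simp add: g_def deg_def flip: sum_distrib_left)
    then show "l * s \<le> (\<Sum>e\<in>E. g e)" using E(2) l by (simp add: mult_left_mono)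
  qed
  also have "\<dots> \<le> exp (m * (l + 2 * l\<^sup>2) * (2 * card A / n) - l * s)"
  proof -
    have "(\<Sum>e\<in>?K. exp (g e) - 1) \<le> (\<Sum>e\<in>?K. (l + 2 * l\<^sup>2) * real (card (e \<inter> A)))"
    proof (rule sum_mono)
      fix e assume "e \<in> ?K"
      then have e: "card e = 2" "finite e" by (auto simp: complete_edges_def intro: card_ge_0_finite)
      let ?x = "real (card (e \<inter> A))"
      have x: "?x \<le> 2" using e card_mono[of e "e \<inter> A"] by simp
      have "l * ?x \<le> (1 / 2) * 2" using x l by (intro mult_mono) auto
      then have "exp (g e) \<le> 1 + l * ?x + (l * ?x)\<^sup>2"
        unfolding g_def using l by (intro exp_bound) auto
      also have "(l * ?x)\<^sup>2 = l\<^sup>2 * (?x * ?x)" by (simp add: power2_eq_square)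
      also have "\<dots> \<le> l\<^sup>2 * (2 * ?x)" using x by (intro mult_left_mono mult_right_mono) auto
      finally show "exp (g e) - 1 \<le> (l + 2 * l\<^sup>2) * ?x" by (simp add: algebra_simps)
    qed
    also have "\<dots> = (l + 2 * l\<^sup>2) * (card A * (real n - 1))"
      using sum_card_Int_kn[OF A] n by (simp flip: sum_distrib_left of_nat_sum add: of_nat_diff)
    finally have "m * (\<Sum>e\<in>?K. exp (g e) - 1) / (n choose 2) \<le> m * ((l + 2 * l\<^sup>2) * (card A * (real n - 1))) / (n choose 2)"
      by (intro divide_right_mono mult_left_mono) auto
    also have "\<dots> = m * (l + 2 * l\<^sup>2) * (2 * card A / n)"
      using n by (simp add: card_kn real_choose_two field_simps)
    finally show ?thesis by simp
  qed
  finally show ?thesis .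
qed

text \<open>The weight is \<open>l\<close> on the pairs inside \<open>U\<close>, whose share among
  all pairs is at most the square of \<open>card U / n\<close>. For small \<open>U\<close> this
  square makes a large \<open>l\<close> affordable.\<close>

lemma prob_dense_subset:
  fixes l s :: real
  assumes U: "U \<subseteq> {1..n}" and m: "m \<le> n choose 2" and n: "n \<ge> 2" and l: "0 \<le> l"
  shows "measure_pmf.prob (graph_process n) {Gs. s \<le> real (card {e \<in> edges (Gs ! m). e \<subseteq> U})}
    \<le> exp (m * (card U / n)\<^sup>2 * exp l - l * s)"
proof -
  let ?K = "kn n"
  have finU: "finite U" using finite_subset[OF U] by simp
  define g where "g e = (if e \<subseteq> U then l else 0)" for e
  have "measure_pmf.prob (graph_process n) {Gs. s \<le> real (card {e \<in> edges (Gs ! m). e \<subseteq> U})} \<le>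
      exp (m * (\<Sum>e\<in>?K. exp (g e) - 1) / (n choose 2) - l * s)"
  proof (rule prob_graph_process_chernoff[OF m])
    fix E :: "nat set set" assume E: "finite E" "s \<le> real (card {e \<in> E. e \<subseteq> U})"
    have "(\<Sum>e\<in>E. g e) = l * real (card {e \<in> E. e \<subseteq> U})"
      using E(1) by (simp add: g_def sum.If_cases Int_def)
    then show "l * s \<le> (\<Sum>e\<in>E. g e)" using E(2) l by (simp add: mult_left_mono)
  qed
  also have "\<dots> \<le> exp (m * (card U / n)\<^sup>2 * exp l - l * s)"
  proof -
    let ?u = "real (card U)"
    have un: "?u \<le> n" using card_mono[OF _ U] by simp
    have "(\<Sum>e\<in>?K. exp (g e) - 1) \<le> (\<Sum>e\<in>?K. if e \<subseteq> U then exp l else 0)"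
      by (intro sum_mono) (simp add: g_def)
    also have "\<dots> = card (complete_edges U) * exp l"
    proof -
      have "{e \<in> ?K. e \<subseteq> U} = complete_edges U" using U by (auto simp: complete_edges_def)
      then show ?thesis by (simp add: sum.If_cases finite_kn Int_def)
    qed
    also have "real (card (complete_edges U)) = ?u * (?u - 1) / 2"
      by (simp add: card_complete_edges finU real_choose_two)
    finally have "m * (\<Sum>e\<in>?K. exp (g e) - 1) / (n choose 2) \<le> m * (?u * (?u - 1) / 2 * exp l) / (n choose 2)"
      by (intro divide_right_mono mult_left_mono) auto
    also have "\<dots> = (m * exp l) * (?u * (?u - 1) / (real n * (real n - 1)))"
      using n by (simp add: card_kn real_choose_two field_simps)
    also have "\<dots> \<le> (m * exp l) * ((?u / n) * (?u / n))"
    proof (rule mult_left_mono)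
      have "(?u - 1) / (real n - 1) \<le> ?u / n" using un n by (simp add: field_simps)
      then have "(?u / n) * ((?u - 1) / (real n - 1)) \<le> (?u / n) * (?u / n)"
        by (intro mult_left_mono) auto
      then show "?u * (?u - 1) / (real n * (real n - 1)) \<le> (?u / n) * (?u / n)" by simp
    qed simp
    finally show ?thesis by (simp add: power2_eq_square mult_ac)
  qed
  finally show ?thesis .
qed

text \<open>
  The weight is \<open>1 / q\<close> on \<open>F\<close>, compensating the factor \<open>q ^ card (F - E)\<close> that comes from
  \<open>prob_edges_before_le\<close>, and \<open>exp (- l)\<close> on the edges from \<open>T\<close> to the complement of \<open>W\<close>; none of
  these lies in \<open>F\<close>, and each contributes to the degree of a single vertex of \<open>T\<close>.
\<close>

lemma prob_tiny_configuration:
  fixes s l :: real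
  assumes F: "F \<subseteq> kn n" and FW: "\<Union> F \<subseteq> W" and T: "T \<subseteq> W" and W: "W \<subseteq> {1..n}"
    and m: "m \<le> M" "M \<le> n choose 2" "M > 0" and l: "l \<ge> 0"
  shows "measure_pmf.prob (graph_process n) {Gs. F \<subseteq> edges (Gs ! M) \<and> (\<forall>t\<in>T. deg (Gs ! m) t < s)} \<le>
    (M / (n choose 2)) ^ card F *
      exp (card F * (m / M) + l * (real (card T) * s) - m * (card T * (real n - card W)) / (n choose 2) * (1 - exp (- l)))"
proof -
  let ?K = "kn n"
  let ?N = "n choose 2"
  let ?p = "pmf_of_set (m_subsets ?K m)"
  define q where "q = real M / ?N"
  define r where "r = (real M - m) / (real ?N - m)"
  define X where "X = edges_between T ({1..n} - W)"
  define Q where "Q E \<longleftrightarrow> (\<forall>t\<in>T. real (card {e \<in> E. t \<in> e}) < s)" for E :: "nat set set"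
  define w where "w e = (if e \<in> F then 1 / q else 1) * (if e \<in> X then exp (- l) else 1)" for e
  have finF: "finite F" by (rule finite_subset[OF F finite_kn])
  have finT: "finite T" "finite W" using finite_subset[OF W] finite_subset[OF T] by simp_all
  have "0 < ?N" using m by linarith
  then have N: "real ?N > 0" "M \<le> real ?N" using m(2) by (simp_all only: of_nat_0_less_iff of_nat_le_iff)
  have q: "q > 0" "q \<le> 1" using m N by (auto simp: q_def)
  \<comment> \<open>\<open>r\<close> is the chance that an edge missing at time \<open>m\<close>
    appears by time \<open>M\<close>; without the conditioning it would be \<open>q\<close>.\<close>
  have r: "0 \<le> r" "r \<le> q"
  proof -
    show "0 \<le> r" using m by (auto simp: r_def)
    show "r \<le> q"
    proof (cases "m = ?N")
      case False
      then have "real ?N - m > 0" using m by simp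
      moreover have "real m * M \<le> real m * ?N" using m by (intro mult_left_mono) auto
      ultimately show ?thesis using N(1) by (simp add: r_def q_def field_simps)
    qed (use q in \<open>simp add: r_def\<close>)
  qed
  have XK: "X \<subseteq> ?K" unfolding X_def using T W by (intro edges_between_subset_kn) auto
  have XF: "X \<inter> F = {}" using FW by (auto simp: X_def edges_between_def)
  have cX: "real (card X) = card T * (real n - card W)"
  proof -
    have "card ({1..n} - W) = n - card W" using W finT by (simp add: card_Diff_subset)
    moreover have "card W \<le> n" using card_mono[OF _ W] by simp
    ultimately have "real (card ({1..n} - W)) = real n - card W" by simp
    then show ?thesis unfolding X_def using T by (subst card_edges_between) auto
  qed
  have set_p: "set_pmf ?p = m_subsets ?K m" using m by (intro set_pmf_m_subsets) simp
  have w0: "w e \<ge> 0" for e using q by (simp add: w_def)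
  have "measure_pmf.prob (graph_process n) {Gs. F \<subseteq> edges (Gs ! M) \<and> (\<forall>t\<in>T. deg (Gs ! m) t < s)} =
    measure_pmf.prob (graph_process n) {Gs. F \<subseteq> edges (Gs ! M) \<and> Q (edges (Gs ! m))}"
    by (simp add: Q_def deg_def)
  also have "\<dots> \<le> measure_pmf.expectation ?p (\<lambda>E. indicator {E. Q E} E * r ^ card (F - E))"
    unfolding r_def by (rule prob_edges_before_le[OF F m(1,2)])
  also have "\<dots> \<le> measure_pmf.expectation ?p (\<lambda>E. (q ^ card F * exp (l * (real (card T) * s))) * (\<Prod>e\<in>E. w e))"
  proof (rule integral_mono_AE)
    show "AE E in ?p. indicator {E. Q E} E * r ^ card (F - E) \<le> (q ^ card F * exp (l * (real (card T) * s))) * (\<Prod>e\<in>E. w e)"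
    proof (rule AE_pmfI)
      fix E assume "E \<in> set_pmf ?p"
      then have finE: "finite E" unfolding set_p by (rule finite_m_subset_kn)
      have w: "(\<Prod>e\<in>E. w e) = (1 / q) ^ card (E \<inter> F) * exp (- l) ^ card (E \<inter> X)"
        using finE by (simp add: w_def prod.distrib prod.If_cases Int_def)
      show "indicator {E. Q E} E * r ^ card (F - E) \<le> (q ^ card F * exp (l * (real (card T) * s))) * (\<Prod>e\<in>E. w e)"
      proof (cases "Q E")
        case True
        have "card (E \<inter> X) \<le> (\<Sum>t\<in>T. card {e \<in> E. t \<in> e})"
          using card_Int_edges_between_le_sum_deg[of T "Graph {} E"] finT finE
          by (simp add: X_def deg_def)
        then have "real (card (E \<inter> X)) \<le> (\<Sum>t\<in>T. real (card {e \<in> E. t \<in> e}))"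
          by (simp flip: of_nat_sum)
        also have "\<dots> \<le> (\<Sum>t\<in>T. s)" using True by (intro sum_mono) (auto simp: Q_def less_imp_le)
        finally have "l * card (E \<inter> X) \<le> l * (real (card T) * s)" using l by (intro mult_left_mono) auto
        then have "1 \<le> exp (l * (real (card T) * s) - l * card (E \<inter> X))" by simp
        also have "\<dots> = exp (l * (real (card T) * s)) * exp (- l) ^ card (E \<inter> X)"
          by (simp add: exp_diff exp_minus power_inverse exp_of_nat_mult[symmetric] divide_inverse mult.commute)
        finally have 1: "1 \<le> exp (l * (real (card T) * s)) * exp (- l) ^ card (E \<inter> X)" .
        have "r ^ card (F - E) \<le> q ^ card (F - E)" using r by (intro power_mono) auto
        also have "card F = card (F - E) + card (E \<inter> F)"
          using card_Diff_subset_Int[of F E] finF card_mono[of F "F \<inter> E"] by (simp add: Int_commute)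
        then have "q ^ card (F - E) = q ^ card F * (1 / q) ^ card (E \<inter> F)"
          using q by (simp add: power_add power_one_over)
        also have "\<dots> \<le> (q ^ card F * (1 / q) ^ card (E \<inter> F)) * (exp (l * (real (card T) * s)) * exp (- l) ^ card (E \<inter> X))"
          using 1 q mult_left_mono[OF 1, of "q ^ card F * (1 / q) ^ card (E \<inter> F)"] by simp
        finally show ?thesis using True by (simp add: w mult_ac)
      next
        case False
        then show ?thesis using q w0 by (simp add: prod_nonneg)
      qed
    qed
  qed (use finite_m_subsets[OF finite_kn] set_p in \<open>auto intro!: integrable_measure_pmf_finite\<close>)
  also have "\<dots> = (q ^ card F * exp (l * (real (card T) * s))) * measure_pmf.expectation ?p (\<lambda>E. \<Prod>e\<in>E. w e)"
    by simp
  also have "\<dots> \<le> (q ^ card F * exp (l * (real (card T) * s))) * exp (m * (\<Sum>e\<in>?K. w e - 1) / card ?K)"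
    using q m w0 by (intro mult_left_mono expectation_prod_m_subsets finite_kn) (auto simp: card_kn)
  also have "\<dots> \<le> (q ^ card F * exp (l * (real (card T) * s))) *
      exp (card F * (m / M) - m * (card T * (real n - card W)) / ?N * (1 - exp (- l)))"
  proof -
    have "(\<Sum>e\<in>?K. w e - 1) = (\<Sum>e\<in>?K. (if e \<in> F then 1 / q - 1 else 0) + (if e \<in> X then exp (- l) - 1 else 0))"
      using XF by (intro sum.cong refl) (auto simp: w_def)
    also have "\<dots> = card F * (1 / q - 1) + card X * (exp (- l) - 1)"
      using F XK by (simp add: sum.distrib sum.If_cases finite_kn Int_absorb1)
    also have "\<dots> \<le> card F * (1 / q) - card X * (1 - exp (- l))" by (simp add: algebra_simps)
    finally have "m * (\<Sum>e\<in>?K. w e - 1) / card ?K \<le> m * (card F * (1 / q) - card X * (1 - exp (- l))) / ?N"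
      unfolding card_kn by (intro divide_right_mono mult_left_mono) auto
    \<comment> \<open>The weight \<open>1 / q\<close> on \<open>F\<close> costs only a constant,
      since \<open>m / (?N * q)\<close> is \<open>m / M\<close>, which is at most 1.\<close>
    also have "\<dots> = card F * (m / M) - m * card X / ?N * (1 - exp (- l))"
      using N m by (simp add: q_def field_simps)
    finally show ?thesis using q by (intro mult_left_mono) (auto simp: cX)
  qed
  also have "\<dots> = (M / ?N) ^ card F *
      exp (card F * (m / M) + l * (real (card T) * s) - m * (card T * (real n - card W)) / ?N * (1 - exp (- l)))"
    by (simp add: q_def exp_add[symmetric] mult.assoc algebra_simps)
  finally show ?thesis .
qed

section \<open>Pseudorandomness and forbidden configurations of tiny vertices\<close>

text \<open>This and the next two predicates provide hypotheses D5, D7 and D8 of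
  \<open>core_resilient\<close> at time \<open>m\<close>, when the average degree is
  \<open>2 * m / n\<close>.\<close>

definition locally_sparse :: "real \<Rightarrow> real \<Rightarrow> nat \<Rightarrow> nat \<Rightarrow> nat ugraph \<Rightarrow> bool" where
  "locally_sparse c \<gamma> n m G \<longleftrightarrow> (\<forall>U \<subseteq> {1..n}. U \<noteq> {} \<and> real (card U) \<le> \<gamma> * real n \<longrightarrow>
     real (card {e \<in> edges G. e \<subseteq> U}) < c * (real m / real n) * real (card U))"

definition degrees_bounded :: "real \<Rightarrow> real \<Rightarrow> nat \<Rightarrow> nat \<Rightarrow> nat ugraph \<Rightarrow> bool" where
  "degrees_bounded \<xi> \<theta> n m G \<longleftrightarrow> (\<forall>A \<subseteq> {1..n}. \<xi> * real n \<le> real (card A) \<longrightarrow>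
     real (\<Sum>v\<in>A. deg G v) \<le> (1 + \<theta>) * real (card A) * (2 * real m / real n))"

definition cuts_dense :: "real \<Rightarrow> real \<Rightarrow> nat \<Rightarrow> nat \<Rightarrow> nat ugraph \<Rightarrow> bool" where
  "cuts_dense \<xi> \<theta> n m G \<longleftrightarrow> (\<forall>A \<subseteq> {1..n}. \<forall>B \<subseteq> {1..n}. A \<inter> B = {} \<and> \<xi> * real n \<le> real (card A) \<and> \<xi> * real n \<le> real (card B) \<longrightarrow>
     (1 - \<theta>) * real (card A) * real (card B) * (2 * real m / real n) / n \<le> real (card (edges G \<inter> edges_between A B)))"

text \<open>\<open>T\<close> and \<open>E\<close> are separate arguments because they are taken at
  different times. In all three configurations the existential over tuples has the form that
  \<open>prob_Ex_le_const\<close> expects.\<close>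

definition path_config :: "nat \<Rightarrow> nat set \<Rightarrow> nat set set \<Rightarrow> bool" where
  "path_config n T E \<longleftrightarrow> (\<exists>(a, b, c) \<in> {1..n} \<times> {1..n} \<times> {1..n}. distinct [a, b, c] \<and>
     {{c, a}, {c, b}} \<subseteq> E \<and> {a, b, c} \<subseteq> T)"

definition star_config :: "nat \<Rightarrow> nat set \<Rightarrow> nat set set \<Rightarrow> bool" where
  "star_config n T E \<longleftrightarrow> (\<exists>(a, b, c, d) \<in> {1..n} \<times> {1..n} \<times> {1..n} \<times> {1..n}. distinct [a, b, c, d] \<and>
     {{d, a}, {d, b}, {d, c}} \<subseteq> E \<and> {a, b, c} \<subseteq> T)"

definition triangle_config :: "nat \<Rightarrow> nat set \<Rightarrow> nat set set \<Rightarrow> bool" where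
  "triangle_config n T E \<longleftrightarrow> (\<exists>(a, b, c) \<in> {1..n} \<times> {1..n} \<times> {1..n}. distinct [a, b, c] \<and>
     {{a, b}, {a, c}, {b, c}} \<subseteq> E \<and> {a, b} \<subseteq> T)"

definition tiny :: "real \<Rightarrow> nat ugraph \<Rightarrow> nat set" where
  "tiny s G = {v. real (deg G v) < s}"

section \<open>Union bounds over vertex sets, vertices and configurations\<close>

lemma prob_Ex_le:
  fixes b :: "'i \<Rightarrow> real"
  assumes "finite I" "\<And>i. i \<in> I \<Longrightarrow> measure_pmf.prob p {x. P i x} \<le> b i"
  shows "measure_pmf.prob p {x. \<exists>i\<in>I. P i x} \<le> sum b I"
proof -
  have "{x. \<exists>i\<in>I. P i x} = (\<Union>i\<in>I. {x. P i x})" by auto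
  then have "measure_pmf.prob p {x. \<exists>i\<in>I. P i x} \<le> (\<Sum>i\<in>I. measure_pmf.prob p {x. P i x})"
    using measure_UNION_le[OF assms(1), of "\<lambda>i. {x. P i x}" "measure_pmf p"] by simp
  also have "\<dots> \<le> sum b I" using assms(2) by (rule sum_mono)
  finally show ?thesis .
qed

lemma prob_Ex_le_const:
  fixes b C :: real
  assumes "finite I" "\<And>i. i \<in> I \<Longrightarrow> measure_pmf.prob p {x. P i x} \<le> b" "card I \<le> C" "b \<ge> 0"
  shows "measure_pmf.prob p {x. \<exists>i\<in>I. P i x} \<le> C * b"
proof -
  have "measure_pmf.prob p {x. \<exists>i\<in>I. P i x} \<le> (\<Sum>i\<in>I. b)"
    using assms by (intro prob_Ex_le) auto
  also have "\<dots> = card I * b" by simp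
  also have "\<dots> \<le> C * b" using assms by (intro mult_right_mono) auto
  finally show ?thesis .
qed

lemma sum_Pow_power_card:
  fixes x :: real
  assumes "finite V"
  shows "(\<Sum>U\<in>Pow V. x ^ card U) = (1 + x) ^ card V"
  using prod_add[OF assms, of "\<lambda>_. x" "\<lambda>_. 1"] by (simp add: add.commute)

text \<open>A set of u vertices is too dense with probability at most n ^ (-20 u), so the union over
  all nonempty sets costs (1 + n ^ (-20)) ^ n - 1, which is of order n ^ (-19). The choice of
  \<open>l\<close> gives l * c = c + 120, where 120 = 6 * 20 and the 6 comes from the lower bound on
  \<open>m\<close>.\<close>

lemma prob_not_locally_sparse:
  assumes n: "n \<ge> 2" and m: "m \<le> n choose 2" "n * ln n / 6 \<le> m"
    and c: "c > 0" "\<gamma> * exp (1 + 120 / c) \<le> c"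
  shows "measure_pmf.prob (graph_process n) {Gs. \<not> locally_sparse c \<gamma> n m (Gs ! m)} \<le> 2 * exp (- (19 * ln n))"
proof -
  define l where "l = 1 + 120 / c"
  define x where "x = exp (- (20 * ln (real n)))"
  let ?P = "\<lambda>U Gs. real (card U) \<le> \<gamma> * real n \<and> c * (real m / real n) * real (card U) \<le> real (card {e \<in> edges (Gs ! m). e \<subseteq> U})"
  have "measure_pmf.prob (graph_process n) {Gs. \<not> locally_sparse c \<gamma> n m (Gs ! m)}
      = measure_pmf.prob (graph_process n) {Gs. \<exists>U\<in>Pow {1..n} - {{}}. ?P U Gs}"
    by (rule arg_cong[where f = "measure_pmf.prob _"]) (auto simp: locally_sparse_def not_less)
  also have "\<dots> \<le> (\<Sum>U\<in>Pow {1..n} - {{}}. x ^ card U)"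
  proof (rule prob_Ex_le)
    fix U assume U: "U \<in> Pow {1..n} - {{}}"
    show "measure_pmf.prob (graph_process n) {Gs. ?P U Gs} \<le> x ^ card U"
    proof (cases "real (card U) \<le> \<gamma> * real n")
      case False
      then show ?thesis by (simp add: x_def)
    next
      case True
      have "measure_pmf.prob (graph_process n) {Gs. ?P U Gs} \<le>
          exp (m * (real (card U) / n)\<^sup>2 * exp l - l * (c * (real m / real n) * real (card U)))"
        using prob_dense_subset[of U n m l "c * (real m / real n) * real (card U)"] U m n c True by (simp add: l_def)
      also have "\<dots> \<le> exp (- (20 * ln n) * real (card U))"
      proof -
        have "real (card U) / n * exp l \<le> \<gamma> * exp l"
          using True n by (intro mult_right_mono) (auto simp: field_simps)
        also have "\<dots> \<le> c" using c by (simp add: l_def)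
        finally have 1: "real (card U) / n * exp l \<le> c" .
        have "m * (real (card U) / n)\<^sup>2 * exp l - l * (c * (real m / real n) * real (card U)) =
            (real m / real n * real (card U)) * (real (card U) / n * exp l - l * c)"
          by (simp add: power2_eq_square algebra_simps)
        also have "\<dots> \<le> (real m / real n * real (card U)) * (- 120)"
        proof (rule mult_left_mono)
          have "l * c = c + 120" using c by (simp add: l_def field_simps)
          then show "real (card U) / n * exp l - l * c \<le> - 120" using 1 by linarith
        qed simp
        also have "\<dots> \<le> (ln n / 6 * real (card U)) * (- 120)"
          using m n by (intro mult_right_mono_neg mult_right_mono) (auto simp: field_simps)
        finally show ?thesis by (simp add: mult_ac)
      qed
      also have "\<dots> = x ^ card U" unfolding x_def by (subst exp_of_nat_mult[symmetric]) (simp add: mult.commute)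
      finally show ?thesis .
    qed
  qed simp
  \<comment> \<open>The subtracted 1 is the term of the empty set.\<close>
  also have "\<dots> = (1 + x) ^ n - 1"
    using sum_Pow_power_card[of "{1..n}" x] by (subst sum_diff1) auto
  also have "\<dots> \<le> 2 * exp (- (19 * ln n))"
  proof -
    have nx: "n * x = exp (- (19 * ln n))"
    proof -
      have "n * x = exp (ln n) * x" using n by simp
      then show ?thesis unfolding x_def by (simp only: exp_add[symmetric]) simp
    qed
    have "(1 + x) ^ n \<le> exp x ^ n" by (intro power_mono exp_ge_add_one_self) (simp add: x_def)
    also have "\<dots> = exp (n * x)" by (simp add: exp_of_nat_mult)
    also have "\<dots> \<le> 1 + n * x + (n * x)\<^sup>2"
      using n by (intro exp_bound) (auto simp: nx)
    also have "(n * x)\<^sup>2 \<le> n * x * 1"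
      unfolding power2_eq_square using n by (intro mult_left_mono) (auto simp: nx)
    finally show ?thesis by (simp add: nx)
  qed
  finally show ?thesis .
qed

text \<open>With \<open>l = \<theta> / 4\<close> the exponent is negative of order n ln n, which
  beats the 2 ^ n choices of \<open>A\<close>. Weakening \<open>\<xi>\<close> to its square gives
  the same exponent as for cuts.\<close>

lemma prob_not_degrees_bounded:
  assumes n: "n \<ge> 2" and m: "m \<le> n choose 2" "n * ln n / 6 \<le> m"
    and \<xi>: "0 < \<xi>" "\<xi> \<le> 1" and \<theta>: "0 < \<theta>" "\<theta> \<le> 1"
  shows "measure_pmf.prob (graph_process n) {Gs. \<not> degrees_bounded \<xi> \<theta> n m (Gs ! m)} \<le>
    2 ^ n * exp (- (\<xi>\<^sup>2 * \<theta>\<^sup>2 / 24 * (n * ln n)))"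
proof -
  let ?P = "\<lambda>A Gs. \<xi> * real n \<le> real (card A) \<and> (1 + \<theta>) * real (card A) * (2 * real m / real n) \<le> real (\<Sum>v\<in>A. deg (Gs ! m) v)"
  have "measure_pmf.prob (graph_process n) {Gs. \<not> degrees_bounded \<xi> \<theta> n m (Gs ! m)}
      \<le> measure_pmf.prob (graph_process n) {Gs. \<exists>A\<in>Pow {1..n}. ?P A Gs}"
    by (rule measure_pmf.finite_measure_mono) (auto simp: degrees_bounded_def not_le intro: less_imp_le)
  also have "\<dots> \<le> 2 ^ n * exp (- (\<xi>\<^sup>2 * \<theta>\<^sup>2 / 24 * (n * ln n)))"
  proof (rule prob_Ex_le_const)
    fix A assume A: "A \<in> Pow {1..n}"
    show "measure_pmf.prob (graph_process n) {Gs. ?P A Gs} \<le> exp (- (\<xi>\<^sup>2 * \<theta>\<^sup>2 / 24 * (n * ln n)))"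
    proof (cases "\<xi> * real n \<le> real (card A)")
      case True
      have "measure_pmf.prob (graph_process n) {Gs. ?P A Gs} \<le>
          exp (m * (\<theta> / 4 + 2 * (\<theta> / 4)\<^sup>2) * (2 * real (card A) / n) - \<theta> / 4 * ((1 + \<theta>) * real (card A) * (2 * real m / real n)))"
        using prob_sum_deg[of A n m "\<theta> / 4" "(1 + \<theta>) * real (card A) * (2 * real m / real n)"] A m n \<theta> True by simp
      also have "\<dots> = exp (- (m * (real (card A) / n) * (\<theta>\<^sup>2 / 4)))"
        using n by (simp add: power2_eq_square field_simps)
      also have "\<dots> \<le> exp (- (\<xi>\<^sup>2 * \<theta>\<^sup>2 / 24 * (n * ln n)))"
      proof -
        have "\<xi>\<^sup>2 * (\<theta>\<^sup>2 / 4) \<le> \<xi> * (\<theta>\<^sup>2 / 4)"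
          using \<xi> by (intro mult_right_mono) (auto simp: power2_eq_square mult_left_le)
        also have "\<dots> \<le> (real (card A) / n) * (\<theta>\<^sup>2 / 4)"
          using True n by (intro mult_right_mono) (auto simp: field_simps)
        finally have "\<xi>\<^sup>2 * (\<theta>\<^sup>2 / 4) \<le> (real (card A) / n) * (\<theta>\<^sup>2 / 4)" .
        then have "(n * ln n / 6) * (\<xi>\<^sup>2 * (\<theta>\<^sup>2 / 4)) \<le> m * ((real (card A) / n) * (\<theta>\<^sup>2 / 4))"
          by (rule mult_mono[OF m(2)]) auto
        then show ?thesis by (simp add: algebra_simps)
      qed
      finally show ?thesis .
    qed simp
  qed (auto simp: card_Pow)
  finally show ?thesis .
qed

text \<open>The lower tail at \<open>l = \<theta> / 2\<close>, against 4 ^ n pairs of sets.\<close>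

lemma prob_not_cuts_dense:
  assumes n: "n \<ge> 2" and m: "m \<le> n choose 2" "n * ln n / 6 \<le> m"
    and \<xi>: "0 < \<xi>" "\<xi> \<le> 1" and \<theta>: "0 < \<theta>" "\<theta> \<le> 1"
  shows "measure_pmf.prob (graph_process n) {Gs. \<not> cuts_dense \<xi> \<theta> n m (Gs ! m)} \<le>
    4 ^ n * exp (- (\<xi>\<^sup>2 * \<theta>\<^sup>2 / 24 * (n * ln n)))"
proof -
  let ?s = "\<lambda>A B. (1 - \<theta>) * real (card A) * real (card B) * (2 * real m / real n) / n"
  let ?Q = "\<lambda>A B. A \<inter> B = {} \<and> \<xi> * real n \<le> real (card A) \<and> \<xi> * real n \<le> real (card B)"
  let ?P = "\<lambda>(A, B) Gs. ?Q A B \<and> real (card (edges (Gs ! m) \<inter> edges_between A B)) \<le> ?s A B"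
  have "measure_pmf.prob (graph_process n) {Gs. \<not> cuts_dense \<xi> \<theta> n m (Gs ! m)}
      \<le> measure_pmf.prob (graph_process n) {Gs. \<exists>AB\<in>Pow {1..n} \<times> Pow {1..n}. ?P AB Gs}"
  proof (rule measure_pmf.finite_measure_mono)
    show "{Gs. \<not> cuts_dense \<xi> \<theta> n m (Gs ! m)} \<subseteq> {Gs. \<exists>AB\<in>Pow {1..n} \<times> Pow {1..n}. ?P AB Gs}"
    proof
      fix Gs assume "Gs \<in> {Gs. \<not> cuts_dense \<xi> \<theta> n m (Gs ! m)}"
      then obtain A B where "A \<subseteq> {1..n}" "B \<subseteq> {1..n}" "?P (A, B) Gs"
        unfolding cuts_dense_def mem_Collect_eq not_all not_imp prod.case by (metis linorder_le_cases)
      then show "Gs \<in> {Gs. \<exists>AB\<in>Pow {1..n} \<times> Pow {1..n}. ?P AB Gs}"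
        by (intro CollectI bexI[of _ "(A, B)"]) auto
    qed
  qed simp
  also have "\<dots> \<le> 4 ^ n * exp (- (\<xi>\<^sup>2 * \<theta>\<^sup>2 / 24 * (n * ln n)))"
  proof (rule prob_Ex_le_const)
    fix AB assume AB: "AB \<in> Pow {1..n} \<times> Pow {1..n}"
    obtain A B where eq: "AB = (A, B)" by (cases AB)
    have sub: "A \<subseteq> {1..n}" "B \<subseteq> {1..n}" using AB eq by auto
    show "measure_pmf.prob (graph_process n) {Gs. ?P AB Gs} \<le> exp (- (\<xi>\<^sup>2 * \<theta>\<^sup>2 / 24 * (n * ln n)))"
    proof (cases "?Q A B")
      case True
      let ?X = "edges_between A B"
      have cX: "real (card ?X) = real (card A) * real (card B)" using True by (simp add: card_edges_between)
      have "measure_pmf.prob (graph_process n) {Gs. ?P AB Gs} \<le>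
          exp (\<theta> / 2 * ?s A B - m * (\<theta> / 2 - (\<theta> / 2)\<^sup>2) * real (card ?X) / (n choose 2))"
        using prob_lower_tail[OF edges_between_subset_kn[OF sub] m(1), of "\<theta> / 2" "?s A B"] \<theta> True eq by simp
      also have "\<dots> \<le> exp (- (m * (real (card A) / n * (real (card B) / n)) * (\<theta>\<^sup>2 / 2)))"
      proof -
        let ?ab = "real (card A) * real (card B)"
        have t: "\<theta> / 2 - (\<theta> / 2)\<^sup>2 \<ge> 0" using \<theta> by (simp add: power2_eq_square mult_left_le)
        \<comment> \<open>The mean of the cut is at least its idealised value, in which the number
          of pairs is replaced by n ^ 2 / 2.\<close>
        have "real n * (real n - 1) \<le> real n * real n" by (intro mult_left_mono) auto
        then have N: "real (n choose 2) \<le> real n * real n / 2" by (simp add: real_choose_two)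
        have N0: "0 < real (n choose 2)" using n by (simp add: real_choose_two)
        have "m * (\<theta> / 2 - (\<theta> / 2)\<^sup>2) * ?ab / (real n * real n / 2) \<le> m * (\<theta> / 2 - (\<theta> / 2)\<^sup>2) * ?ab / (n choose 2)"
          using N N0 t n by (intro divide_left_mono mult_nonneg_nonneg) auto
        moreover have "\<theta> / 2 * ?s A B - m * (\<theta> / 2 - (\<theta> / 2)\<^sup>2) * ?ab / (real n * real n / 2)
            = - (m * (real (card A) / n * (real (card B) / n)) * (\<theta>\<^sup>2 / 2))"
          using n by (simp add: field_simps power2_eq_square)
        ultimately show ?thesis by (simp add: cX)
      qed
      also have "\<dots> \<le> exp (- (\<xi>\<^sup>2 * \<theta>\<^sup>2 / 24 * (n * ln n)))"
      proof -
        have "\<xi> * \<xi> \<le> real (card A) / n * (real (card B) / n)"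
          using True n \<xi> by (intro mult_mono) (auto simp: field_simps)
        then have "(n * ln n / 6) * (\<xi> * \<xi>) \<le> m * (real (card A) / n * (real (card B) / n))"
          using \<xi> by (intro mult_mono[OF m(2)]) auto
        then have "(n * ln n / 6) * (\<xi> * \<xi>) * (\<theta>\<^sup>2 / 2) \<le> m * (real (card A) / n * (real (card B) / n)) * (\<theta>\<^sup>2 / 2)"
          by (intro mult_right_mono) auto
        moreover have "\<xi>\<^sup>2 * \<theta>\<^sup>2 / 24 * (n * ln n) \<le> (n * ln n / 6) * (\<xi> * \<xi>) * (\<theta>\<^sup>2 / 2)"
          using n \<theta> \<xi> by (simp add: power2_eq_square)
        ultimately show ?thesis by (simp only: exp_le_cancel_iff neg_le_iff_le)
      qed
      finally show ?thesis .
    next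
      case False
      then have "{Gs. ?P AB Gs} = {}" unfolding eq by auto
      then show ?thesis by (simp only: measure_empty exp_ge_zero)
    qed
  qed (auto simp: card_Pow card_cartesian_product power_mult_distrib[symmetric])
  finally show ?thesis .
qed

text \<open>The mean degree is 2 m / n, and the lower tail at \<open>l = 1 / 4\<close> gives exp (-
  m / (8 n)), at most n ^ (-5). This leaves enough for a union over all vertices and all
  times.\<close>

lemma prob_low_degree:
  assumes n: "n \<ge> 2" and m: "m \<le> n choose 2" "40 * (n * ln n) \<le> m"
  shows "measure_pmf.prob (graph_process n) {Gs. \<exists>v\<in>{1..n}. real (deg (Gs ! m) v) < real m / real n} \<le> n * exp (- (5 * ln n))"
proof (rule prob_Ex_le_const)
  fix v assume v: "v \<in> {1..n}"
  let ?X = "edges_between {v} ({1..n} - {v})"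
  have X: "?X \<subseteq> kn n" using v by (intro edges_between_subset_kn) auto
  have cX: "real (card ?X) = real n - 1"
    using v n by (subst card_edges_between) (auto simp: of_nat_diff)
  have "measure_pmf.prob (graph_process n) {Gs. real (deg (Gs ! m) v) < real m / real n} \<le>
      measure_pmf.prob (graph_process n) {Gs. real (card (edges (Gs ! m) \<inter> ?X)) \<le> real m / real n}"
  \<comment> \<open>The inclusion is claimed only on the support: an infinite edge set could have
    the default degree 0.\<close>
  proof (rule measure_pmf.finite_measure_mono_AE)
    show "AE Gs in graph_process n. Gs \<in> {Gs. real (deg (Gs ! m) v) < real m / real n} \<longrightarrow>
        Gs \<in> {Gs. real (card (edges (Gs ! m) \<inter> ?X)) \<le> real m / real n}"
    proof (rule AE_pmfI)
      fix Gs assume "Gs \<in> set_pmf (graph_process n)"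
      then have "is_run n (n choose 2) Gs" using is_run_upto[of "n choose 2" n Gs] by (simp add: graph_process_def)
      then have "finite (edges (Gs ! m))" using is_runD(3) m finite_kn finite_subset by meson
      then show "Gs \<in> {Gs. real (deg (Gs ! m) v) < real m / real n} \<longrightarrow>
          Gs \<in> {Gs. real (card (edges (Gs ! m) \<inter> ?X)) \<le> real m / real n}"
        using card_Int_edges_between_le_sum_deg[of "{v}" "Gs ! m" "{1..n} - {v}"] by auto
    qed
  qed simp
  also have "\<dots> \<le> exp (1 / 4 * (real m / real n) - m * (1 / 4 - (1 / 4)\<^sup>2) * real (card ?X) / (n choose 2))"
    using m by (intro prob_lower_tail X) auto
  also have "\<dots> = exp (- (m / (8 * n)))"
  proof -
    have q: "(real n - 1) / (n choose 2) = 2 / n" using n by (simp add: real_choose_two divide_simps)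
    have "m * (1 / 4 - (1 / 4)\<^sup>2) * real (card ?X) / (n choose 2) = m * (3 / 16) * ((real n - 1) / (n choose 2))"
      unfolding cX by (simp add: power2_eq_square)
    then show ?thesis unfolding q by simp
  qed
  also have "\<dots> \<le> exp (- (5 * ln n))" using m n by (simp add: field_simps)
  finally show "measure_pmf.prob (graph_process n) {Gs. real (deg (Gs ! m) v) < real m / real n} \<le> exp (- (5 * ln n))" .
qed auto

text \<open>Each tiny vertex contributes a factor of about n ^ (- (1 + epsilon) / 3). Halving
  \<open>\<epsilon>\<close> pays for the loss \<open>exp (- l)\<close> and for
  \<open>l * \<delta>\<close>. The constant 12 is 3 + 3 * 3: the contribution of \<open>F\<close>,
  plus 3 for each vertex of \<open>T\<close>.\<close>

lemma prob_tiny_configuration_le: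
  fixes \<epsilon> \<delta> l :: real
  assumes F: "F \<subseteq> kn n" and FW: "\<Union> F \<subseteq> W" and T: "T \<subseteq> W" and W: "W \<subseteq> {1..n}" "card W \<le> 4"
    and m: "m \<le> M" "M \<le> n choose 2" "M > 0" "(1 + \<epsilon>) / 6 * n * ln n \<le> m" and n: "n \<ge> 4"
    and \<epsilon>: "0 < \<epsilon>" "\<epsilon> \<le> 1" and l: "l \<ge> 0" "exp (- l) = \<epsilon> / 8" "l * \<delta> \<le> \<epsilon> / 24"
    and c: "card F \<le> 3" "card T \<le> 3"
  shows "measure_pmf.prob (graph_process n) {Gs. F \<subseteq> edges (Gs ! M) \<and> T \<subseteq> tiny (\<delta> * ln n) (Gs ! m)} \<le>
    (M / (n choose 2)) ^ card F * exp (12 - card T / 3 * (1 + \<epsilon> / 2) * ln n)"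
proof -
  let ?N = "n choose 2" and ?L = "ln (real n)" and ?t = "real (card T)"
  have L: "0 \<le> ?L" "?L \<le> n" using n ln_le_minus_one[of n] by auto
  have "measure_pmf.prob (graph_process n) {Gs. F \<subseteq> edges (Gs ! M) \<and> T \<subseteq> tiny (\<delta> * ?L) (Gs ! m)} =
      measure_pmf.prob (graph_process n) {Gs. F \<subseteq> edges (Gs ! M) \<and> (\<forall>t\<in>T. deg (Gs ! m) t < \<delta> * ?L)}"
    by (rule arg_cong[where f = "measure_pmf.prob _"]) (auto simp: tiny_def)
  also have "\<dots> \<le> (M / ?N) ^ card F * exp (card F * (m / M) + l * (?t * (\<delta> * ?L)) -
      m * (?t * (real n - card W)) / ?N * (1 - exp (- l)))"
    by (rule prob_tiny_configuration[OF F FW T W(1) m(1-3) l(1)])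
  also have "\<dots> \<le> (M / ?N) ^ card F * exp (12 - ?t / 3 * (1 + \<epsilon> / 2) * ?L)"
  proof (intro mult_left_mono, subst exp_le_cancel_iff)
    have eqs: "?t * ((1 + 3 * \<epsilon> / 4) / 3 * ?L - 3) = ?t * ?L / 3 + \<epsilon> * (?t * ?L) / 4 - ?t * 3"
      "?t / 3 * (1 + \<epsilon> / 2) * ?L = ?t * ?L / 3 + \<epsilon> * (?t * ?L) / 6"
      by (simp_all add: field_simps)
    have "card F * (real m / M) \<le> 3 * 1" using m c by (intro mult_mono) auto
    moreover have "l * (?t * (\<delta> * ?L)) \<le> \<epsilon> * (?t * ?L) / 24"
      using mult_right_mono[OF l(3), of "?t * ?L"] L by (simp add: mult_ac)
    moreover have "?t * ((1 + 3 * \<epsilon> / 4) / 3 * ?L - 3) \<le> m * (?t * (real n - card W)) / ?N * (1 - exp (- l))"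
    proof -
      have "(1 + \<epsilon>) / 3 * ?L * (1 - 4 / n) = (1 + \<epsilon>) / 6 * n * ?L * (real n - 4) / (real n * real n / 2)"
        using n by (simp add: field_simps)
      also have "\<dots> \<le> m * (real n - card W) / (real n * real n / 2)"
        using m n W L \<epsilon> by (intro divide_right_mono mult_mono) auto
      also have "\<dots> \<le> m * (real n - card W) / ?N"
      proof (rule divide_left_mono)
        have "real n * (real n - 1) \<le> real n * real n" by (intro mult_left_mono) auto
        then show "real ?N \<le> real n * real n / 2" by (simp add: real_choose_two)
        show "0 < real n * real n / 2 * real ?N" using n by (simp add: real_choose_two)
      qed (use n W in auto)
      finally have 1: "(1 + \<epsilon>) / 3 * ?L * (1 - 4 / n) \<le> m * (real n - card W) / ?N" .
      \<comment> \<open>As ln n is at most n, replacing n by n - 4 costs at most 8 / 3.\<close>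
      have "(1 + 3 * \<epsilon> / 4) / 3 * ?L - 3 \<le> (1 + 3 * \<epsilon> / 4) / 3 * (?L * (1 - 4 / n))"
      proof -
        define x where "x = (1 + 3 * \<epsilon> / 4) / 3"
        define y where "y = ?L * (4 / n)"
        have "y \<le> 4" "0 \<le> y" using L n by (simp_all add: y_def field_simps)
        then have "x * y \<le> 2 / 3 * 4" using \<epsilon> by (intro mult_mono) (auto simp: x_def)
        moreover have "?L * (1 - 4 / n) = ?L - y" by (simp add: y_def right_diff_distrib)
        ultimately have "x * ?L - 3 \<le> x * (?L * (1 - 4 / n))" by (simp add: right_diff_distrib)
        then show ?thesis by (simp only: x_def)
      qed
      also have "\<dots> \<le> ((1 + \<epsilon>) * (1 - \<epsilon> / 8)) / 3 * (?L * (1 - 4 / n))"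
      proof (intro mult_right_mono divide_right_mono)
        have "\<epsilon> * \<epsilon> \<le> \<epsilon> * 1" using \<epsilon> by (intro mult_left_mono) auto
        then show "1 + 3 * \<epsilon> / 4 \<le> (1 + \<epsilon>) * (1 - \<epsilon> / 8)" by (simp add: algebra_simps add_divide_distrib)
      qed (use L n in auto)
      also have "\<dots> = (1 + \<epsilon>) / 3 * ?L * (1 - 4 / n) * (1 - \<epsilon> / 8)" by simp
      also have "\<dots> \<le> m * (real n - card W) / ?N * (1 - \<epsilon> / 8)"
        using 1 \<epsilon> by (intro mult_right_mono) auto
      finally have "?t * ((1 + 3 * \<epsilon> / 4) / 3 * ?L - 3) \<le> ?t * (m * (real n - card W) / ?N * (1 - \<epsilon> / 8))"
        by (intro mult_left_mono) auto
      then show ?thesis by (simp add: l(2) mult_ac)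
    qed
    moreover have "?t * 3 \<le> 3 * 3" using c by (intro mult_right_mono) auto
    moreover have "0 \<le> \<epsilon> * (?t * ?L)" using \<epsilon> L by (intro mult_nonneg_nonneg) auto
    ultimately show "card F * (m / M) + l * (?t * (\<delta> * ?L)) - m * (?t * (real n - card W)) / ?N * (1 - exp (- l))
        \<le> 12 - ?t / 3 * (1 + \<epsilon> / 2) * ?L"
      unfolding eqs by linarith
  qed simp
  finally show ?thesis .
qed

text \<open>Here \<open>q\<close> is going to be of order ln n / n. Path and star have one vertex
  more than edges, which leaves a factor n; their three tiny vertices just beat it, and this is
  where the 6 in the threshold comes from. A triangle has as many edges as vertices, so two tiny
  vertices suffice.\<close>

lemma prob_configs:
  fixes \<epsilon> \<delta> l q :: real
  assumes m: "m \<le> M" "M \<le> n choose 2" "M > 0" "(1 + \<epsilon>) / 6 * n * ln n \<le> m" and n: "n \<ge> 4"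
    and \<epsilon>: "0 < \<epsilon>" "\<epsilon> \<le> 1" and l: "l \<ge> 0" "exp (- l) = \<epsilon> / 8" "l * \<delta> \<le> \<epsilon> / 24"
    and q: "M / (n choose 2) \<le> q"
  shows "measure_pmf.prob (graph_process n) {Gs. path_config n (tiny (\<delta> * ln n) (Gs ! m)) (edges (Gs ! M))}
      \<le> real n ^ 3 * (q\<^sup>2 * exp (12 - (1 + \<epsilon> / 2) * ln n))" (is ?path)
    and "measure_pmf.prob (graph_process n) {Gs. star_config n (tiny (\<delta> * ln n) (Gs ! m)) (edges (Gs ! M))}
      \<le> real n ^ 4 * (q ^ 3 * exp (12 - (1 + \<epsilon> / 2) * ln n))" (is ?star)
    and "measure_pmf.prob (graph_process n) {Gs. triangle_config n (tiny (\<delta> * ln n) (Gs ! m)) (edges (Gs ! M))}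
      \<le> real n ^ 3 * (q ^ 3 * exp (12 - 2 / 3 * (1 + \<epsilon> / 2) * ln n))" (is ?triangle)
proof -
  let ?V = "{1..n}" and ?T = "\<lambda>Gs. tiny (\<delta> * ln n) (Gs ! m)"
  have q0: "0 \<le> M / (n choose 2)" by simp
  then have q1: "q \<ge> 0" using q by linarith
  have base: "measure_pmf.prob (graph_process n) {Gs. F \<subseteq> edges (Gs ! M) \<and> T \<subseteq> ?T Gs}
      \<le> q ^ f * exp (12 - t / 3 * (1 + \<epsilon> / 2) * ln n)"
    if "F \<subseteq> kn n" "\<Union> F \<subseteq> W" "T \<subseteq> W" "W \<subseteq> ?V" "card W \<le> 4" "card F = f" "card T = t" "f \<le> 3" "t \<le> 3"
    for F T W f t
  proof -
    have "(M / (n choose 2)) ^ f \<le> q ^ f" using q by (intro power_mono) auto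
    then show ?thesis
      using prob_tiny_configuration_le[OF that(1-5) m n \<epsilon> l] that(6-9)
      by (smt (verit, best) exp_gt_zero mult_right_mono)
  qed
  show ?path unfolding path_config_def
  proof (rule prob_Ex_le_const)
    fix x assume x: "x \<in> ?V \<times> ?V \<times> ?V"
    obtain a b c where abc: "x = (a, b, c)" by (cases x)
    show "measure_pmf.prob (graph_process n) {Gs. case x of (a, b, c) \<Rightarrow> distinct [a, b, c] \<and>
        {{c, a}, {c, b}} \<subseteq> edges (Gs ! M) \<and> {a, b, c} \<subseteq> ?T Gs} \<le> q\<^sup>2 * exp (12 - (1 + \<epsilon> / 2) * ln n)"
    proof (cases "distinct [a, b, c]")
      case True
      have "measure_pmf.prob (graph_process n) {Gs. {{c, a}, {c, b}} \<subseteq> edges (Gs ! M) \<and> {a, b, c} \<subseteq> ?T Gs}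
          \<le> q ^ 2 * exp (12 - real 3 / 3 * (1 + \<epsilon> / 2) * ln n)"
        by (rule base[where W = "{a, b, c}"]) (use x abc True in \<open>auto simp: complete_edges_def doubleton_eq_iff\<close>)
      then show ?thesis using True by (simp only: abc prod.case simp_thms) simp
    qed (simp only: abc prod.case simp_thms, use q1 in simp)
  qed (use q1 in \<open>auto simp: card_cartesian_product power3_eq_cube\<close>)
  show ?star unfolding star_config_def
  proof (rule prob_Ex_le_const)
    fix x assume x: "x \<in> ?V \<times> ?V \<times> ?V \<times> ?V"
    obtain a b c d where abc: "x = (a, b, c, d)" by (cases x)
    show "measure_pmf.prob (graph_process n) {Gs. case x of (a, b, c, d) \<Rightarrow> distinct [a, b, c, d] \<and>
        {{d, a}, {d, b}, {d, c}} \<subseteq> edges (Gs ! M) \<and> {a, b, c} \<subseteq> ?T Gs} \<le> q ^ 3 * exp (12 - (1 + \<epsilon> / 2) * ln n)"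
    proof (cases "distinct [a, b, c, d]")
      case True
      have "measure_pmf.prob (graph_process n) {Gs. {{d, a}, {d, b}, {d, c}} \<subseteq> edges (Gs ! M) \<and> {a, b, c} \<subseteq> ?T Gs}
          \<le> q ^ 3 * exp (12 - real 3 / 3 * (1 + \<epsilon> / 2) * ln n)"
        by (rule base[where W = "{a, b, c, d}"]) (use x abc True in \<open>auto simp: complete_edges_def doubleton_eq_iff\<close>)
      then show ?thesis using True by (simp only: abc prod.case simp_thms) simp
    qed (simp only: abc prod.case simp_thms, use q1 in simp)
  qed (use q1 in \<open>auto simp: card_cartesian_product power4_eq_xxxx\<close>)
  show ?triangle unfolding triangle_config_def
  proof (rule prob_Ex_le_const)
    fix x assume x: "x \<in> ?V \<times> ?V \<times> ?V"
    obtain a b c where abc: "x = (a, b, c)" by (cases x)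
    show "measure_pmf.prob (graph_process n) {Gs. case x of (a, b, c) \<Rightarrow> distinct [a, b, c] \<and>
        {{a, b}, {a, c}, {b, c}} \<subseteq> edges (Gs ! M) \<and> {a, b} \<subseteq> ?T Gs} \<le> q ^ 3 * exp (12 - 2 / 3 * (1 + \<epsilon> / 2) * ln n)"
    proof (cases "distinct [a, b, c]")
      case True
      have "measure_pmf.prob (graph_process n) {Gs. {{a, b}, {a, c}, {b, c}} \<subseteq> edges (Gs ! M) \<and> {a, b} \<subseteq> ?T Gs}
          \<le> q ^ 3 * exp (12 - real 2 / 3 * (1 + \<epsilon> / 2) * ln n)"
        by (rule base[where W = "{a, b, c}"]) (use x abc True in \<open>auto simp: complete_edges_def doubleton_eq_iff\<close>)
      then show ?thesis using True by (simp only: abc prod.case simp_thms) simp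
    qed (simp only: abc prod.case simp_thms, use q1 in simp)
  qed (use q1 in \<open>auto simp: card_cartesian_product power3_eq_cube\<close>)
qed

section \<open>Runs without bad events have resilient cores\<close>

text \<open>About \<open>\<xi> * n\<close> tiny vertices would send at least ln n / 12 edges per
  vertex to their complement by cut density, but their degrees are below ln n / 24.\<close>

lemma card_tiny_le:
  fixes \<xi> \<theta> \<delta> :: real
  assumes cd: "cuts_dense \<xi> \<theta> n m G" and V: "edges G \<subseteq> kn n"
    and m: "n * ln n / 6 \<le> m" and n: "n \<ge> 2" "1 \<le> \<xi> * n" and \<xi>: "0 < \<xi>" "\<xi> \<le> 1 / 4"
    and \<theta>: "0 < \<theta>" "\<theta> \<le> 1 / 2" and \<delta>: "\<delta> \<le> 1 / 24" "T \<subseteq> {1..n}" "T \<subseteq> tiny (\<delta> * ln n) G"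
  shows "card T \<le> \<xi> * n"
proof (rule ccontr)
  assume "\<not> card T \<le> \<xi> * n"
  then have T: "nat \<lceil>\<xi> * n\<rceil> \<le> card T" by linarith
  obtain A where A: "A \<subseteq> T" "card A = nat \<lceil>\<xi> * n\<rceil>"
    using T by (meson obtain_subset_with_card_n)
  define B where "B = {1..n} - A"
  have finA: "finite A" using A \<delta> by (meson finite_atLeastAtMost finite_subset)
  \<comment> \<open>Rounding up at most doubles \<open>\<xi> * n\<close>, which is at least
    1.\<close>
  have a: "\<xi> * n \<le> card A" "card A \<le> 2 * (\<xi> * n)" using A n by linarith+
  have "\<xi> * n \<le> 1 / 4 * n" using \<xi> by (intro mult_right_mono) auto
  then have an: "card A \<le> real n / 2" "\<xi> * n \<le> real n / 2" using a by linarith+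
  have "card B = n - card A" unfolding B_def using A \<delta> finA by (subst card_Diff_subset) auto
  then have b: "real n / 2 \<le> card B" using an by linarith
  have Apos: "real (card A) > 0" using a n by linarith
  have L: "ln (real n) > 0" using n by simp
  have finE: "finite (edges G)" using V finite_kn by (rule finite_subset)
  have AB: "A \<subseteq> {1..n}" "B \<subseteq> {1..n}" "A \<inter> B = {}" using A \<delta> by (auto simp: B_def)
  have "\<xi> * n \<le> card B" using b an by linarith
  then have "(1 - \<theta>) * card A * card B * (2 * real m / real n) / n \<le> real (card (edges G \<inter> edges_between A B))"
    using cd[unfolded cuts_dense_def, rule_format, of A B] AB a by simp
  also have "\<dots> \<le> real (\<Sum>v\<in>A. deg G v)"
    unfolding of_nat_le_iff by (rule card_Int_edges_between_le_sum_deg[OF finA finE])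
  also have "\<dots> \<le> (\<Sum>v\<in>A. \<delta> * ln n)"
    unfolding of_nat_sum using A \<delta> by (intro sum_mono) (auto simp: tiny_def less_imp_le)
  also have "\<dots> = card A * (\<delta> * ln n)" by simp
  finally have "card A * ((1 - \<theta>) * card B * (2 * real m / real n) / n) \<le> card A * (\<delta> * ln n)"
    by (simp add: mult_ac)
  then have "(1 - \<theta>) * card B * (2 * real m / real n) / n \<le> \<delta> * ln n"
    using Apos by (simp only: mult_le_cancel_left_pos)
  moreover have "(1 / 2) * (real n / 2) * (2 * (n * ln n / 6) / n) / n \<le> (1 - \<theta>) * card B * (2 * real m / real n) / n"
    using \<theta> b m n L by (intro divide_right_mono mult_mono) auto
  moreover have "(1 / 2) * (real n / 2) * (2 * (n * ln n / 6) / n) / n = ln n / 12" using n by simp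
  moreover have "\<delta> * ln n \<le> 1 / 24 * ln n" using \<delta> L by (intro mult_right_mono) auto
  ultimately show False using L by linarith
qed

text \<open>Before time \<open>m1\<close>, tininess is fixed at \<open>m0\<close> and the absence of
  configurations is inherited from \<open>m1\<close>, since edges are only added. From
  \<open>m1\<close> on \<open>T\<close> is empty, the hypotheses about \<open>T\<close> are trivial,
  and \<open>m / n\<close> serves as the degree bound.\<close>

lemma run_resilient:
  fixes k n m m0 m1 :: nat and \<epsilon> \<theta> \<xi> \<delta> c :: real
  assumes run: "is_run n (n choose 2) Gs" and k: "k \<ge> 2"
    and m: "m0 \<le> m" "m \<le> n choose 2" "m1 \<le> n choose 2"
    and m0: "n * ln n / 6 \<le> m0" and m1: "40 * (n * ln n) \<le> m1" "m1 \<le> 41 * (n * ln n)"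
    and sparse: "locally_sparse c (2 * \<xi>) n m (Gs ! m)"
    and degs: "degrees_bounded \<xi> \<theta> n m (Gs ! m)"
    and cuts: "cuts_dense \<xi> \<theta> n m (Gs ! m)" "cuts_dense \<xi> \<theta> n m0 (Gs ! m0)"
    and high: "m1 \<le> m \<Longrightarrow> \<forall>v\<in>{1..n}. real m / real n \<le> real (deg (Gs ! m) v)"
    and path: "\<not> path_config n (tiny (\<delta> * ln n) (Gs ! m0)) (edges (Gs ! m1))"
    and star: "\<not> star_config n (tiny (\<delta> * ln n) (Gs ! m0)) (edges (Gs ! m1))"
    and triangle: "\<not> triangle_config n (tiny (\<delta> * ln n) (Gs ! m0)) (edges (Gs ! m1))"
    and par: "0 < \<theta>" "\<theta> \<le> 1 / 2" "0 < \<xi>" "\<xi> \<le> 1 / 4" "\<theta> + \<xi> < \<epsilon>" "\<epsilon> \<le> 1 / 4" "0 < \<delta>" "\<delta> \<le> 1 / 24"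
    and c: "c = \<delta> / (1640 * k)" \<comment> \<open>\<open>1640 = 40 * 41\<close>, with 40 from \<open>core_resilient\<close> and 41 from \<open>m1\<close>\<close>
    and n: "n \<ge> 2" "k \<le> \<xi> * n" "k + 4 \<le> \<delta> * ln n"
  shows "resilient (1 / 2 - \<epsilon>) k (k_connected k) (k_core k (Gs ! m))"
proof -
  let ?G = "Gs ! m" and ?L = "ln (real n)"
  define T where "T = (if m < m1 then {1..n} \<inter> tiny (\<delta> * ?L) (Gs ! m0) else {})"
  define D where "D = (if m < m1 then \<delta> * ?L else m / n)"
  note R = is_runD[OF run]
  have V: "verts ?G = {1..n}" "edges ?G \<subseteq> kn n" "edges (Gs ! m0) \<subseteq> kn n" "edges (Gs ! m1) \<subseteq> kn n"
    using R m by auto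
  have sub: "edges ?G \<subseteq> edges (Gs ! m1)" if "m < m1" using R(5)[of m m1] that m by simp
  have L: "?L > 0" using n by simp
  have npos: "real n > 0" using n by simp
  have T: "T \<subseteq> {1..n}" "T \<subseteq> tiny (\<delta> * ?L) (Gs ! m0)" by (auto simp: T_def)
  have Tm: "m < m1" if "v \<in> T" for v using that by (simp add: T_def split: if_splits)
  have m_pos: "real m > 0"
  proof -
    have "0 < n * ln n / 6" using L npos by simp
    then show ?thesis using m0 m(1) by linarith
  qed
  \<comment> \<open>The first bound yields \<open>k + 4 \<le> D\<close>; the second lets local
    sparsity, which is stated relative to \<open>m / n\<close>, be compared with \<open>D\<close> in
    both regimes.\<close>
  have DL: "\<delta> * ?L \<le> D \<and> \<delta> / 41 * (m / n) \<le> D"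
  proof (cases "m < m1")
    case True
    then have "m / n \<le> 41 * ?L" using m1 npos by (simp add: field_simps)
    then have "\<delta> / 41 * (m / n) \<le> \<delta> / 41 * (41 * ?L)" using par by (intro mult_left_mono) auto
    then show ?thesis using True by (simp add: D_def)
  next
    case False
    then have "40 * (n * ?L) \<le> m" using m1 by linarith
    then have "40 * ?L \<le> m / n" using npos by (simp add: field_simps)
    moreover have "\<delta> * ?L \<le> 40 * ?L" using par L by (intro mult_right_mono) auto
    moreover have "\<delta> / 41 * (m / n) \<le> 1 * (m / n)" using par by (intro mult_right_mono) auto
    ultimately show ?thesis using False by (simp add: D_def)
  qed
  have Dk: "real (k + 4) \<le> D" using DL n by simp
  have Tfin: "finite T" using T(1) finite_subset by auto
  note ed = complete_edgesD[OF V(2)]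
  show ?thesis
  proof (rule core_resilient[where T = T and D = D and \<theta> = \<theta> and \<xi> = \<xi> and r = "2 * real m / real n"])
    show "2 \<le> k" by (rule k)
    show "finite (verts ?G)" "edges ?G \<subseteq> complete_edges (verts ?G)" "T \<subseteq> verts ?G" using V T by simp_all
    show "card (nbrs (edges ?G) v \<inter> T) \<le> 1" if v: "v \<in> T" for v
    proof (rule ccontr)
      assume "\<not> ?thesis"
      then have "2 \<le> card (nbrs (edges ?G) v \<inter> T)" by linarith
      then obtain Y where "Y \<subseteq> nbrs (edges ?G) v \<inter> T" "card Y = 2" by (meson obtain_subset_with_card_n)
      then obtain a b where ab: "a \<noteq> b" "a \<in> T" "b \<in> T" "{v, a} \<in> edges ?G" "{v, b} \<in> edges ?G"
        by (auto simp: card_2_iff nbrs_def)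
      have "path_config n (tiny (\<delta> * ?L) (Gs ! m0)) (edges (Gs ! m1))"
        unfolding path_config_def
        by (rule bexI[of _ "(a, b, v)"]) (use ab ed[OF ab(4)] ed[OF ab(5)] v T sub[OF Tm[OF v]] in auto)
      then show False using path by simp
    qed
    show "card (nbrs (edges ?G) v \<inter> T) \<le> 2" if v: "v \<in> verts ?G" for v
    proof (rule ccontr)
      assume "\<not> ?thesis"
      then have "3 \<le> card (nbrs (edges ?G) v \<inter> T)" by linarith
      then obtain Y where "Y \<subseteq> nbrs (edges ?G) v \<inter> T" "card Y = 3" by (meson obtain_subset_with_card_n)
      then obtain a b d where ab: "a \<noteq> b" "a \<noteq> d" "b \<noteq> d" "a \<in> T" "b \<in> T" "d \<in> T"
        "{v, a} \<in> edges ?G" "{v, b} \<in> edges ?G" "{v, d} \<in> edges ?G"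
        by (auto simp: card_3_iff nbrs_def)
      have "star_config n (tiny (\<delta> * ?L) (Gs ! m0)) (edges (Gs ! m1))"
        unfolding star_config_def
        by (rule bexI[of _ "(a, b, d, v)"])
          (use ab ed[OF ab(7)] ed[OF ab(8)] ed[OF ab(9)] T sub[OF Tm[OF ab(4)]] in auto)
      then show False using star by simp
    qed
    show False if t: "u \<in> T" "v \<in> T" "{u, v} \<in> edges ?G" "{u, s} \<in> edges ?G" "{v, s} \<in> edges ?G" for u v s
    proof -
      have "triangle_config n (tiny (\<delta> * ?L) (Gs ! m0)) (edges (Gs ! m1))"
        unfolding triangle_config_def
        by (rule bexI[of _ "(u, v, s)"])
          (use t ed[OF t(3)] ed[OF t(4)] ed[OF t(5)] T sub[OF Tm[OF t(1)]] in auto)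
      then show False using triangle by simp
    qed
    show "D \<le> deg ?G v" if v: "v \<in> verts ?G - T" for v
    proof (cases "m < m1")
      case True
      then have "\<delta> * ?L \<le> deg (Gs ! m0) v" using v V by (auto simp: T_def tiny_def)
      also have "deg (Gs ! m0) v \<le> deg ?G v"
        unfolding deg_def using R(5)[of m0 m] m finite_subset[OF V(2) finite_kn] by (intro card_mono) auto
      finally show ?thesis using True by (simp add: D_def)
    next
      case False
      then show ?thesis using high v V by (auto simp: D_def)
    qed
    show "real (card {e \<in> edges ?G. e \<subseteq> U}) < D / real (40 * k) * real (card U)"
      if U: "U \<subseteq> verts ?G" "U \<noteq> {}" "real (card U) \<le> 2 * \<xi> * real (card (verts ?G))" for U
    proof -
      have "real (card {e \<in> edges ?G. e \<subseteq> U}) < c * (real m / real n) * real (card U)"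
        using sparse U V unfolding locally_sparse_def by auto
      also have "\<dots> \<le> D / real (40 * k) * real (card U)"
      proof (rule mult_right_mono)
        have "c * (real m / real n) = \<delta> / 41 * (m / n) / real (40 * k)" by (simp add: c)
        also have "\<dots> \<le> D / real (40 * k)" using DL by (intro divide_right_mono) auto
        finally show "c * (real m / real n) \<le> D / real (40 * k)" .
      qed simp
      finally show ?thesis .
    qed
    have "1 \<le> \<xi> * n" using n k by linarith
    then show "real (card T) \<le> \<xi> * real (card (verts ?G))"
      using card_tiny_le[OF cuts(2) V(3) m0 n(1) _ par(3,4,1,2,8) T] V by simp
    show "real (\<Sum>v\<in>A. deg ?G v) \<le> (1 + \<theta>) * real (card A) * (2 * real m / real n)"
      if "A \<subseteq> verts ?G" "\<xi> * real (card (verts ?G)) \<le> real (card A)" for A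
      using degs that V unfolding degrees_bounded_def by auto
    show "(1 - \<theta>) * real (card A) * real (card B) * (2 * real m / real n) / real (card (verts ?G))
        \<le> real (card (edges ?G \<inter> edges_between A B))"
      if "A \<subseteq> verts ?G" "B \<subseteq> verts ?G" "A \<inter> B = {}" "\<xi> * real (card (verts ?G)) \<le> real (card A)"
        "\<xi> * real (card (verts ?G)) \<le> real (card B)" for A B
      using cuts(1) that V unfolding cuts_dense_def by auto
    show "real k \<le> \<xi> * real (card (verts ?G))" using n V by simp
    show "0 < 2 * real m / real n" using m_pos npos by simp
  qed (use Dk par in auto)
qed

section \<open>Union bound and asymptotics\<close>

lemma prob_disj_le:
  "measure_pmf.prob p {x. P x \<or> Q x} \<le> measure_pmf.prob p {x. P x} + measure_pmf.prob p {x. Q x}"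
  using measure_Un_le[of "{x. P x}" "measure_pmf p" "{x. Q x}"] by (simp add: Un_def)

text \<open>The first four terms carry n ^ 2 for the number of times \<open>m\<close>. The last
  three belong to the configurations, which concern only \<open>m0\<close> and \<open>m1\<close>;
  there 82 ln n / (n - 1) bounds the edge density at time \<open>m1\<close>.\<close>

definition failure_bound :: "real \<Rightarrow> real \<Rightarrow> nat \<Rightarrow> real" where
  "failure_bound \<kappa> \<epsilon> n =
     real n ^ 2 * (2 * exp (- (19 * ln (real n)))) +
     real n ^ 2 * (2 ^ n * exp (- (\<kappa> * (real n * ln (real n))))) +
     real n ^ 2 * (4 ^ n * exp (- (\<kappa> * (real n * ln (real n))))) +
     real n ^ 2 * (real n * exp (- (5 * ln (real n)))) +
     real n ^ 3 * ((82 * ln (real n) / (real n - 1))\<^sup>2 * exp (12 - (1 + \<epsilon> / 2) * ln (real n))) +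
     real n ^ 4 * ((82 * ln (real n) / (real n - 1)) ^ 3 * exp (12 - (1 + \<epsilon> / 2) * ln (real n))) +
     real n ^ 3 * ((82 * ln (real n) / (real n - 1)) ^ 3 * exp (12 - 2 / 3 * (1 + \<epsilon> / 2) * ln (real n)))"

lemma failure_bound_tendsto:
  assumes "\<kappa> > 0" "\<epsilon> > 0"
  shows "failure_bound \<kappa> \<epsilon> \<longlonglongrightarrow> 0"
proof -
  have "(\<lambda>n. real n ^ 2 * (2 * exp (- (19 * ln (real n))))) \<longlonglongrightarrow> 0"
    "(\<lambda>n. real n ^ 2 * (2 ^ n * exp (- (\<kappa> * (real n * ln (real n)))))) \<longlonglongrightarrow> 0"
    "(\<lambda>n. real n ^ 2 * (4 ^ n * exp (- (\<kappa> * (real n * ln (real n)))))) \<longlonglongrightarrow> 0"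
    "(\<lambda>n. real n ^ 2 * (real n * exp (- (5 * ln (real n))))) \<longlonglongrightarrow> 0"
    "(\<lambda>n. real n ^ 3 * ((82 * ln (real n) / (real n - 1))\<^sup>2 * exp (12 - (1 + \<epsilon> / 2) * ln (real n)))) \<longlonglongrightarrow> 0"
    "(\<lambda>n. real n ^ 4 * ((82 * ln (real n) / (real n - 1)) ^ 3 * exp (12 - (1 + \<epsilon> / 2) * ln (real n)))) \<longlonglongrightarrow> 0"
    "(\<lambda>n. real n ^ 3 * ((82 * ln (real n) / (real n - 1)) ^ 3 * exp (12 - 2 / 3 * (1 + \<epsilon> / 2) * ln (real n)))) \<longlonglongrightarrow> 0"
    using assms by real_asymp+
  from tendsto_add[OF tendsto_add[OF tendsto_add[OF tendsto_add[OF tendsto_add[OF tendsto_add[OF this(1,2)]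
      this(3)] this(4)] this(5)] this(6)] this(7)]
  show ?thesis by (simp add: failure_bound_def[abs_def])
qed

abbreviation resilient_cores :: "nat \<Rightarrow> real \<Rightarrow> nat \<Rightarrow> nat ugraph list set" where
  "resilient_cores k \<epsilon> n \<equiv> {Gs. \<forall>m::nat. (1 + \<epsilon>) / 6 * real n * ln (real n) \<le> real m \<and> m \<le> n choose 2 \<longrightarrow>
     resilient (1 / 2 - \<epsilon>) k (k_connected k) (k_core k (Gs ! m))}"

text \<open>The bad events \<open>?B1\<close> to \<open>?B7\<close> follow the order of the terms of
  \<open>failure_bound\<close>; a run outside all of them satisfies \<open>run_resilient\<close> at
  every time in the range.\<close>

lemma prob_resilient_cores_ge:
  fixes k n :: nat and \<epsilon> \<theta> \<xi> \<delta> c l :: real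
  assumes k: "k \<ge> 2"
    and par: "0 < \<theta>" "\<theta> \<le> 1 / 2" "0 < \<xi>" "\<xi> \<le> 1 / 4" "\<theta> + \<xi> < \<epsilon>" "\<epsilon> \<le> 1 / 4" "0 < \<delta>" "\<delta> \<le> 1 / 24"
    and c: "c = \<delta> / (1640 * k)" "2 * \<xi> * exp (1 + 120 / c) \<le> c"
    and l: "l \<ge> 0" "exp (- l) = \<epsilon> / 8" "l * \<delta> \<le> \<epsilon> / 24"
    and n: "n \<ge> 4" "k \<le> \<xi> * n" "k + 4 \<le> \<delta> * ln n" "1 \<le> n * ln n"
      "41 * (real n * ln (real n)) \<le> real n * (real n - 1) / 2"
  shows "1 - failure_bound (\<xi>\<^sup>2 * \<theta>\<^sup>2 / 24) \<epsilon> n \<le> measure_pmf.prob (graph_process n) (resilient_cores k \<epsilon> n)"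
proof -
  let ?N = "n choose 2" and ?p = "graph_process n" and ?L = "ln (real n)"
  define m0 where "m0 = nat \<lceil>(1 + \<epsilon>) / 6 * real n * ?L\<rceil>"
  define m1 where "m1 = nat \<lceil>40 * (real n * ?L)\<rceil>"
  define tn where "tn Gs = tiny (\<delta> * ?L) (Gs ! m0)" for Gs
  have \<epsilon>: "0 < \<epsilon>" "\<epsilon> \<le> 1" using par by linarith+
  have m0: "(1 + \<epsilon>) / 6 * real n * ?L \<le> m0" by (simp add: m0_def real_nat_ceiling_ge)
  have nL: "real n * ?L \<le> (1 + \<epsilon>) * (real n * ?L)" "(1 + \<epsilon>) * (real n * ?L) \<le> 2 * (real n * ?L)"
    using n(4) \<epsilon> mult_right_mono[of 1 "1 + \<epsilon>" "real n * ?L"] mult_right_mono[of "1 + \<epsilon>" 2 "real n * ?L"] by simp_all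
  have eq: "(1 + \<epsilon>) / 6 * real n * ?L = (1 + \<epsilon>) * (real n * ?L) / 6" by simp
  have m0': "real n * ?L / 6 \<le> m0" using m0 nL unfolding eq by linarith
  have m1: "40 * (real n * ?L) \<le> m1" by (simp add: m1_def real_nat_ceiling_ge)
  have m1': "m1 \<le> 41 * (real n * ?L)" using n(4) unfolding m1_def by linarith
  have m01: "m0 \<le> m1" unfolding m0_def m1_def eq using nL n(4) by (intro nat_mono ceiling_mono) linarith
  have "real m1 \<le> real ?N" using m1' n(5) by (simp add: real_choose_two)
  then have m1N: "m1 \<le> ?N" by simp
  have m1pos: "m1 > 0" using m1 n(4) by linarith
  have q: "m1 / ?N \<le> 82 * ?L / (real n - 1)"
  proof -
    have "m1 / ?N \<le> 41 * (real n * ?L) / ?N" using m1' by (intro divide_right_mono) auto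
    also have "\<dots> = 82 * ?L / (real n - 1)" using n(1) by (simp add: real_choose_two field_simps)
    finally show ?thesis .
  qed
  have N2: "real (card {a..?N}) \<le> real n ^ 2" for a
  proof -
    have "real (card {a..?N}) \<le> real ?N + 1" by simp
    also have "\<dots> \<le> real n ^ 2"
    proof -
      have "x * (x - 1) / 2 + 1 \<le> x * x" if "4 \<le> x" for x :: real
        using that mult_mono[of 4 x 4 x] by (simp add: field_simps)
      from this[of "real n"] have "real n * (real n - 1) / 2 + 1 \<le> real n * real n" using n(1) by simp
      then show ?thesis by (simp add: real_choose_two power2_eq_square)
    qed
    finally show ?thesis .
  qed
  have n2: "n \<ge> 2" using n by simp
  let ?\<kappa> = "\<xi>\<^sup>2 * \<theta>\<^sup>2 / 24"
  let ?B1 = "\<lambda>Gs. \<exists>m\<in>{m0..?N}. \<not> locally_sparse c (2 * \<xi>) n m (Gs ! m)"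
  let ?B2 = "\<lambda>Gs. \<exists>m\<in>{m0..?N}. \<not> degrees_bounded \<xi> \<theta> n m (Gs ! m)"
  let ?B3 = "\<lambda>Gs. \<exists>m\<in>{m0..?N}. \<not> cuts_dense \<xi> \<theta> n m (Gs ! m)"
  let ?B4 = "\<lambda>Gs. \<exists>m\<in>{m1..?N}. \<exists>v\<in>{1..n}. real (deg (Gs ! m) v) < real m / real n"
  let ?B5 = "\<lambda>Gs. path_config n (tn Gs) (edges (Gs ! m1))"
  let ?B6 = "\<lambda>Gs. star_config n (tn Gs) (edges (Gs ! m1))"
  let ?B7 = "\<lambda>Gs. triangle_config n (tn Gs) (edges (Gs ! m1))"
  let ?Bad = "\<lambda>Gs. (((((?B1 Gs \<or> ?B2 Gs) \<or> ?B3 Gs) \<or> ?B4 Gs) \<or> ?B5 Gs) \<or> ?B6 Gs) \<or> ?B7 Gs"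
  have late: "real n * ?L / 6 \<le> real m" if "m \<in> {m0..?N}" for m
    using that m0' by (meson atLeastAtMost_iff of_nat_mono order_trans)
  have B1: "measure_pmf.prob ?p {Gs. ?B1 Gs} \<le> real n ^ 2 * (2 * exp (- (19 * ?L)))"
    by (rule prob_Ex_le_const[OF finite_atLeastAtMost prob_not_locally_sparse[OF n2 _ late]])
      (use N2 c par k in auto)
  have B2: "measure_pmf.prob ?p {Gs. ?B2 Gs} \<le> real n ^ 2 * (2 ^ n * exp (- (?\<kappa> * (real n * ?L))))"
    by (rule prob_Ex_le_const[OF finite_atLeastAtMost prob_not_degrees_bounded[OF n2 _ late]]) (use N2 par in auto)
  have B3: "measure_pmf.prob ?p {Gs. ?B3 Gs} \<le> real n ^ 2 * (4 ^ n * exp (- (?\<kappa> * (real n * ?L))))"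
    by (rule prob_Ex_le_const[OF finite_atLeastAtMost prob_not_cuts_dense[OF n2 _ late]]) (use N2 par in auto)
  have late1: "40 * (real n * ?L) \<le> real m" if "m \<in> {m1..?N}" for m
    using that m1 by (meson atLeastAtMost_iff of_nat_mono order_trans)
  have B4: "measure_pmf.prob ?p {Gs. ?B4 Gs} \<le> real n ^ 2 * (real n * exp (- (5 * ?L)))"
    by (rule prob_Ex_le_const[OF finite_atLeastAtMost prob_low_degree[OF n2 _ late1]]) (use N2 in auto)
  note B57 = prob_configs[OF m01 m1N m1pos m0 n(1) \<epsilon> l q]
  have "measure_pmf.prob ?p {Gs. ?Bad Gs} \<le>
      measure_pmf.prob ?p {Gs. ?B1 Gs} + measure_pmf.prob ?p {Gs. ?B2 Gs} + measure_pmf.prob ?p {Gs. ?B3 Gs} +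
      measure_pmf.prob ?p {Gs. ?B4 Gs} + measure_pmf.prob ?p {Gs. ?B5 Gs} + measure_pmf.prob ?p {Gs. ?B6 Gs} +
      measure_pmf.prob ?p {Gs. ?B7 Gs}"
    by (intro order_trans[OF prob_disj_le] add_right_mono) (rule order_refl)
  also have "\<dots> \<le> failure_bound ?\<kappa> \<epsilon> n"
    unfolding failure_bound_def tn_def by (intro add_mono B1 B2 B3 B4 B57)
  finally have bad: "measure_pmf.prob ?p {Gs. ?Bad Gs} \<le> failure_bound ?\<kappa> \<epsilon> n" .
  have "measure_pmf.prob ?p (- resilient_cores k \<epsilon> n) \<le> measure_pmf.prob ?p {Gs. ?Bad Gs}"
  proof (rule measure_pmf.finite_measure_mono_AE)
    show "AE Gs in ?p. Gs \<in> - resilient_cores k \<epsilon> n \<longrightarrow> Gs \<in> {Gs. ?Bad Gs}"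
    proof (intro AE_pmfI impI)
      fix Gs assume "Gs \<in> set_pmf ?p" and nr: "Gs \<in> - resilient_cores k \<epsilon> n"
      then have run: "is_run n ?N Gs" using is_run_upto[of ?N n Gs] by (simp add: graph_process_def)
      show "Gs \<in> {Gs. ?Bad Gs}"
      proof (rule ccontr)
        assume "Gs \<notin> {Gs. ?Bad Gs}"
        then have nb: "\<not> ?B1 Gs" "\<not> ?B2 Gs" "\<not> ?B3 Gs" "\<not> ?B4 Gs" "\<not> ?B5 Gs" "\<not> ?B6 Gs" "\<not> ?B7 Gs"
          by (simp_all only: mem_Collect_eq de_Morgan_disj simp_thms)
        have "resilient (1 / 2 - \<epsilon>) k (k_connected k) (k_core k (Gs ! m))"
          if m: "(1 + \<epsilon>) / 6 * real n * ?L \<le> real m" "m \<le> ?N" for m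
        proof -
          have m0m: "m0 \<le> m" unfolding m0_def using m(1) by linarith
          then have mem: "m \<in> {m0..?N}" "m0 \<in> {m0..?N}" using m by auto
          show ?thesis
          proof (rule run_resilient[OF run k m0m m(2) m1N m0' m1 m1' _ _ _ _ _ _ _ _ par c(1) n2 n(2,3)])
            show "locally_sparse c (2 * \<xi>) n m (Gs ! m)" "degrees_bounded \<xi> \<theta> n m (Gs ! m)"
              "cuts_dense \<xi> \<theta> n m (Gs ! m)" "cuts_dense \<xi> \<theta> n m0 (Gs ! m0)"
              using nb(1-3) mem by blast+
            show "\<forall>v\<in>{1..n}. real m / real n \<le> real (deg (Gs ! m) v)" if "m1 \<le> m"
              using nb(4) that m(2) by (meson atLeastAtMost_iff not_less)
          qed (use nb(5-7) in \<open>simp_all add: tn_def\<close>)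
        qed
        then show False using nr by simp
      qed
    qed
  qed simp
  then have "measure_pmf.prob ?p (- resilient_cores k \<epsilon> n) \<le> failure_bound ?\<kappa> \<epsilon> n" using bad by linarith
  moreover have "measure_pmf.prob ?p (- resilient_cores k \<epsilon> n) = 1 - measure_pmf.prob ?p (resilient_cores k \<epsilon> n)"
    using measure_pmf.prob_compl[of "resilient_cores k \<epsilon> n" ?p] by (simp add: Compl_eq_Diff_UNIV)
  ultimately show ?thesis by linarith
qed

text \<open>The constants are fixed in the order \<open>\<theta>\<close>, \<open>l\<close>,
  \<open>\<delta>\<close>, \<open>c\<close>, \<open>\<xi>\<close>. The last one has to be
  exponentially small in \<open>1 / c\<close> for local sparsity to hold.\<close>

lemma resilient_cores_tendsto:
  fixes k :: nat and \<epsilon> :: real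
  assumes k: "k \<ge> 2" and \<epsilon>: "\<epsilon> > 0" "\<epsilon> \<le> 1 / 4"
  shows "(\<lambda>n. measure_pmf.prob (graph_process n) (resilient_cores k \<epsilon> n)) \<longlonglongrightarrow> 1"
proof -
  define \<theta> where "\<theta> = \<epsilon> / 4"
  define l where "l = ln (8 / \<epsilon>)"
  have l: "l > 0" "exp (- l) = \<epsilon> / 8" using \<epsilon> by (simp_all add: l_def exp_minus)
  define \<delta> where "\<delta> = min (1 / 24) (\<epsilon> / (24 * l))"
  have \<delta>: "0 < \<delta>" "\<delta> \<le> 1 / 24" using \<epsilon> l by (simp_all add: \<delta>_def)
  have "l * \<delta> \<le> l * (\<epsilon> / (24 * l))" using l by (intro mult_left_mono) (simp_all add: \<delta>_def)
  then have l\<delta>: "l * \<delta> \<le> \<epsilon> / 24" using l by simp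
  define c where "c = \<delta> / real (1640 * k)"
  have c: "c > 0" using \<delta> k by (simp add: c_def)
  define \<xi> where "\<xi> = min (\<epsilon> / 4) (c * exp (- (1 + 120 / c)) / 2)"
  have \<xi>: "0 < \<xi>" "\<xi> \<le> \<epsilon> / 4" using \<epsilon> c by (simp_all add: \<xi>_def)
  have "2 * \<xi> * exp (1 + 120 / c) \<le> 2 * (c * exp (- (1 + 120 / c)) / 2) * exp (1 + 120 / c)"
    by (intro mult_right_mono mult_left_mono) (simp_all add: \<xi>_def)
  also have "\<dots> = c" by (simp only: exp_minus) simp
  finally have c\<xi>: "2 * \<xi> * exp (1 + 120 / c) \<le> c" .
  let ?\<kappa> = "\<xi>\<^sup>2 * \<theta>\<^sup>2 / 24"
  have large: "\<forall>\<^sub>F n in at_top. n \<ge> 4 \<and> real k \<le> \<xi> * real n \<and> real (k + 4) \<le> \<delta> * ln (real n)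
     \<and> 1 \<le> real n * ln (real n) \<and> 41 * (real n * ln (real n)) \<le> real n * (real n - 1) / 2"
  proof (intro eventually_conj)
    show "\<forall>\<^sub>F n in at_top. real (k + 4) \<le> \<delta> * ln (real n)" using \<delta> by real_asymp
    show "\<forall>\<^sub>F n in at_top. real k \<le> \<xi> * real n" using \<xi> by real_asymp
  qed real_asymp+
  show ?thesis
  proof (rule tendsto_sandwich[where h = "\<lambda>_. 1"])
    show "\<forall>\<^sub>F n in at_top. 1 - failure_bound ?\<kappa> \<epsilon> n \<le> measure_pmf.prob (graph_process n) (resilient_cores k \<epsilon> n)"
      using large
    proof eventually_elim
      case (elim n)
      show ?case
        by (rule prob_resilient_cores_ge[where \<delta> = \<delta> and c = c and l = l])
          (use k \<epsilon> \<delta> \<xi> l l\<delta> c\<xi> elim in \<open>simp_all add: \<theta>_def c_def\<close>)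
    qed
    have "?\<kappa> > 0" using \<xi> \<epsilon> by (simp add: \<theta>_def)
    from tendsto_diff[OF tendsto_const failure_bound_tendsto[OF this \<epsilon>(1)], of 1]
    show "(\<lambda>n. 1 - failure_bound ?\<kappa> \<epsilon> n) \<longlonglongrightarrow> 1" by simp
  qed simp_all
qed

lemma resilient_antimono:
  assumes "\<alpha> \<le> \<beta>" "resilient \<beta> k P G"
  shows "resilient \<alpha> k P G"
  unfolding resilient_def
proof (intro allI impI, elim conjE)
  fix H assume H: "spanning_subgraph H G" "\<forall>v\<in>verts G. real (deg H v) \<le> \<alpha> * real (deg G v)"
    "\<forall>v\<in>verts G. k \<le> deg (graph_diff G H) v"
  have "real (deg H v) \<le> \<beta> * real (deg G v)" if "v \<in> verts G" for v
    using H(2) that mult_right_mono[OF assms(1), of "real (deg G v)"] by fastforce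
  then show "P (graph_diff G H)" using assms(2) H by (simp add: resilient_def)
qed

theorem theorem1p5:
  fixes k :: nat and \<epsilon> :: real
  assumes "k \<ge> 2" and "\<epsilon> > 0"
  shows "(\<lambda>n. measure_pmf.prob (graph_process n)
           {Gs. \<forall>m::nat. (1 + \<epsilon>) / 6 * real n * ln (real n) \<le> real m \<and> m \<le> n choose 2 \<longrightarrow>
                  resilient (1 / 2 - \<epsilon>) k (k_connected k) (k_core k (Gs ! m))})
         \<longlonglongrightarrow> 1"
proof -
  \<comment> \<open>A smaller constant gives a stronger claim, since the range of \<open>m\<close>
    grows and \<open>H\<close> may be larger. So it may be assumed to be at most 1 / 4.\<close>
  define \<epsilon>' where "\<epsilon>' = min \<epsilon> (1 / 4)"
  have \<epsilon>': "\<epsilon>' > 0" "\<epsilon>' \<le> 1 / 4" "\<epsilon>' \<le> \<epsilon>" using assms(2) by (simp_all add: \<epsilon>'_def)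
  have sub: "resilient_cores k \<epsilon>' n \<subseteq> resilient_cores k \<epsilon> n" for n
  proof (intro subsetI CollectI allI impI, elim conjE)
    fix Gs and m :: nat
    assume Gs: "Gs \<in> resilient_cores k \<epsilon>' n"
      and m: "(1 + \<epsilon>) / 6 * real n * ln (real n) \<le> real m" "m \<le> n choose 2"
    have "0 \<le> real n * ln (real n)" by (cases "n = 0") auto
    then have "(1 + \<epsilon>') / 6 * (real n * ln (real n)) \<le> (1 + \<epsilon>) / 6 * (real n * ln (real n))"
      using \<epsilon>' by (intro mult_right_mono) auto
    then have "(1 + \<epsilon>') / 6 * real n * ln (real n) \<le> real m" using m(1) by (simp only: mult.assoc)
    then have "resilient (1 / 2 - \<epsilon>') k (k_connected k) (k_core k (Gs ! m))" using Gs m(2) by blast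
    then show "resilient (1 / 2 - \<epsilon>) k (k_connected k) (k_core k (Gs ! m))"
      using \<epsilon>' by (intro resilient_antimono[of "1 / 2 - \<epsilon>" "1 / 2 - \<epsilon>'"]) auto
  qed
  show ?thesis
  proof (rule tendsto_sandwich[where h = "\<lambda>_. 1", OF always_eventually always_eventually])
    show "\<forall>n. measure_pmf.prob (graph_process n) (resilient_cores k \<epsilon>' n)
        \<le> measure_pmf.prob (graph_process n) (resilient_cores k \<epsilon> n)"
      using measure_pmf.finite_measure_mono[OF sub] by simp
    show "(\<lambda>n. measure_pmf.prob (graph_process n) (resilient_cores k \<epsilon>' n)) \<longlonglongrightarrow> 1"
      by (rule resilient_cores_tendsto[OF assms(1) \<epsilon>'(1,2)])
  qed simp_all
qed

end
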